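(* Let $n\ge 1$, $r,t,s\ge 0$ be integers, and let $1\le \alpha_1<\cdots<\alpha_r<\frac n2$, $1\le \beta_1<\cdots<\beta_t<\frac n2$, $0\le\gamma_1<\cdots<\gamma_s\le n-1$ be integers. Let $\Gamma_1,\Gamma_2,\Gamma_3,\Gamma_4$ be the associated bicirculant graphs on $2n$ vertices and $P_1,P_2,P_3,P_4$ the associated Laurent polynomials, as defined in the context ($\Gamma_2,\Gamma_3,\Gamma_4$ are considered only when $n$ is even). Assume the graph under consideration is connected, and assume that $P_1,P_2,P_3,P_4$ all have the same degree $k$. Let $a_k,b_k,c_k,d_k$ be the leading coefficients (coefficients of $z^k$) of $P_1,P_2,P_3,P_4$, respectively, and let $w_\ell$, $v_\ell$, $u_\ell$, $y_\ell$ ($\ell=1,\dots,k$) be all the complex roots, listed with multiplicity, of the Chebyshev transforms of $P_1,P_2,P_3,P_4$, respectively. Let $f_{\Gamma}(2n)$ denote the number of rooted spanning forests of $\Gamma$. Then: (1) $f_{\Gamma_1}(2n)=|a_k|^n\prod_{\ell=1}^{k}|2T_n(w_{\ell})-2|$; (2) if $n$ is even, $f_{\Gamma_2}(2n)=|b_k|^{\frac n2}|a_k|^{\frac n2}\prod_{\ell=1}^{k}|2T_{\frac n2}(v_{\ell})+2|\prod_{\ell=1}^{k}|2T_{\frac n2}(w_{\ell})-2|$; (3) if $n$ is even, $f_{\Gamma_3}(2n)=|c_k|^{\frac n2}|a_k|^{\frac n2}\prod_{\ell=1}^{k}|2T_{\frac n2}(u_{\ell})+2|\prod_{\ell=1}^{k}|2T_{\frac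 n2}(w_{\ell})-2|$; (4) if $n$ is even, $f_{\Gamma_4}(2n)=|d_k|^{\frac n2}|a_k|^{\frac n2}\prod_{\ell=1}^{k}|2T_{\frac n2}(y_{\ell})+2|\prod_{\ell=1}^{k}|2T_{\frac n2}(w_{\ell})-2|$.
   Context: Bicirculant graph: for $R=-R\subseteq\mathbb Z_n\setminus\{0\}$, $T=-T\subseteq\mathbb Z_n\setminus\{0\}$, $S\subseteq\mathbb Z_n$, the simple undirected graph $BC(\mathbb Z_n;R,T,S)$ has vertex set $\{g_0: g\in\mathbb Z_n\}\sqcup\{g_1: g\in\mathbb Z_n\}$ ($2n$ vertices) and edges $\{h_0,g_0\}$ when $g-h\in R$, $\{h_1,g_1\}$ when $g-h\in T$, and $\{h_0,g_1\}$ when $g-h\in S$. The four graphs (integers reduced mod $n$): put $R=\{\pm\alpha_1,\dots,\pm\alpha_r\}$, $T=\{\pm\beta_1,\dots,\pm\beta_t\}$, $S=\{\gamma_1,\dots,\gamma_s\}$. Then $\Gamma_1=BC(\mathbb Z_n;R,T,S)$ and, for $n$ even, $\Gamma_2=BC(\mathbb Z_n;R\cup\{\frac n2\},T,S)$, $\Gamma_3=BC(\mathbb Z_n;R,T\cup\{\frac n2\},S)$, $\Gamma_4=BC(\mathbb Z_n;R\cup\{\frac n2\},T\cup\{\frac n2\},S)$. Polynomials: $\mathcal A(z)=2r+s+1-\sum_{j=1}^r(z^{\alpha_j}+z^{-\alpha_j})$, $\mathcal B(z)=2t+s+1-\sum_{j=1}^t(z^{\beta_j}+z^{-\beta_j})$,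 $\mathcal C(z)=-\sum_{j=1}^s z^{\gamma_j}$, and $P_1(z)=\mathcal A(z)\mathcal B(z)-\mathcal C(z^{-1})\mathcal C(z)$, $P_2(z)=(\mathcal A(z)+2)\mathcal B(z)-\mathcal C(z^{-1})\mathcal C(z)$, $P_3(z)=\mathcal A(z)(\mathcal B(z)+2)-\mathcal C(z^{-1})\mathcal C(z)$, $P_4(z)=(\mathcal A(z)+2)(\mathcal B(z)+2)-\mathcal C(z^{-1})\mathcal C(z)$. Each is a Laurent polynomial with integer coefficients satisfying $P_j(z)=P_j(z^{-1})$. The degree of such a Laurent polynomial is the largest exponent of $z$ with nonzero coefficient. Chebyshev: $T_m$ is the Chebyshev polynomial of the first kind ($T_m(\cos\theta)=\cos m\theta$), evaluated at complex arguments. The Chebyshev transform of $P(z)=\eta_0+\sum_{j=1}^k\eta_j(z^j+z^{-j})$ is the polynomial $U(w)=\eta_0+\sum_{j=1}^k 2\eta_jT_j(w)$ (so $P(z)=U(\frac12(z+z^{-1}))$), which has degree $k$ when $\eta_k\ne0$. Rooted spanning forest of a graph $\Gamma$: an acyclic subgraph containing all vertices of $\Gamma$, together with a choice of one vertex (root) in each of its connected components. Empty products are $1$. *)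

theory Defs
  imports
    "HOL-Analysis.Analysis"
    "HOL-Library.Poly_Mapping"
    "HOL-Computational_Algebra.Polynomial"
begin

section \<open>Simple undirected graphs and rooted spanning forests\<close>

text \<open>
  A graph is given by its vertex set and a set of two-element edges \<open>{u, v}\<close>.  (A symmetric
  digraph would be inconvenient here, because each undirected edge would be a directed cycle of
  length 2.)
\<close>

record 'a ugraph =
  uverts :: "'a set"
  uedges :: "'a set set"

definition uadj :: "'a ugraph \<Rightarrow> 'a rel" where
  "uadj G = {(u, v). {u, v} \<in> uedges G}"

definition ureach :: "'a ugraph \<Rightarrow> 'a rel" where
  "ureach G = (uadj G)\<^sup>* \<inter> (uverts G \<times> uverts G)"

definition ucomponents :: "'a ugraph \<Rightarrow> 'a set set" where
  "ucomponents G = uverts G // ureach G"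

definition uconnected :: "'a ugraph \<Rightarrow> bool" where
  "uconnected G \<longleftrightarrow> uverts G \<noteq> {} \<and> (\<forall>u\<in>uverts G. \<forall>v\<in>uverts G. (u, v) \<in> ureach G)"

definition ucycle :: "'a ugraph \<Rightarrow> 'a list \<Rightarrow> bool" where
  "ucycle G vs \<longleftrightarrow> length vs \<ge> 3 \<and> distinct vs \<and> set vs \<subseteq> uverts G
     \<and> successively (\<lambda>u v. {u, v} \<in> uedges G) vs \<and> {last vs, hd vs} \<in> uedges G"

definition uacyclic :: "'a ugraph \<Rightarrow> bool" where
  "uacyclic G \<longleftrightarrow> (\<nexists>vs. ucycle G vs)"

text \<open>A rooted spanning forest is a pair of its edge set \<open>F\<close> and its set of roots \<open>X\<close>.\<close>

definition rooted_spanning_forests :: "'a ugraph \<Rightarrow> ('a set set \<times> 'a set) set" where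
  "rooted_spanning_forests G =
     {(F, X). F \<subseteq> uedges G \<and> uacyclic (G\<lparr>uedges := F\<rparr>) \<and> X \<subseteq> uverts G
        \<and> (\<forall>C \<in> ucomponents (G\<lparr>uedges := F\<rparr>). \<exists>!x. x \<in> C \<and> x \<in> X)}"

definition num_rooted_spanning_forests :: "'a ugraph \<Rightarrow> nat" where
  "num_rooted_spanning_forests G = card (rooted_spanning_forests G)"

section \<open>Bicirculant graphs\<close>

text \<open>
  Elements of the integers modulo \<open>n\<close> are represented by \<open>{0..<n}\<close>; the sets \<open>R\<close>, \<open>T\<close>, \<open>S\<close> consist
  of such representatives.  The vertices \<open>g\<^sub>0\<close> and \<open>g\<^sub>1\<close> are the pairs \<open>(0, g)\<close> and \<open>(1, g)\<close>.
\<close>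

definition bicirculant ::
    "nat \<Rightarrow> int set \<Rightarrow> int set \<Rightarrow> int set \<Rightarrow> (nat \<times> int) ugraph" where
  "bicirculant n R T S =
     \<lparr>uverts = {0, 1} \<times> {0..<int n},
      uedges =
        {{(0, h), (0, g)} | h g. h \<in> {0..<int n} \<and> g \<in> {0..<int n} \<and> (g - h) mod int n \<in> R}
      \<union> {{(1, h), (1, g)} | h g. h \<in> {0..<int n} \<and> g \<in> {0..<int n} \<and> (g - h) mod int n \<in> T}
      \<union> {{(0, h), (1, g)} | h g. h \<in> {0..<int n} \<and> g \<in> {0..<int n} \<and> (g - h) mod int n \<in> S}\<rparr>"

definition pm_residues :: "nat \<Rightarrow> nat \<Rightarrow> (nat \<Rightarrow> int) \<Rightarrow> int set" where
  "pm_residues n r \<alpha> = (\<Union>j\<in>{1..r}. {\<alpha> j mod int n, (- \<alpha> j) mod int n})"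

definition residues_of :: "nat \<Rightarrow> nat \<Rightarrow> (nat \<Rightarrow> int) \<Rightarrow> int set" where
  "residues_of n s \<gamma> = (\<lambda>j. \<gamma> j mod int n) ` {1..s}"

section \<open>Integer Laurent polynomials\<close>

text \<open>
  The ring of integer Laurent polynomials is the ring of finitely supported functions from
  exponents (of type \<open>int\<close>) to coefficients, with the convolution product of \<open>Poly_Mapping\<close>.
\<close>

type_synonym laurent = "int \<Rightarrow>\<^sub>0 int"

abbreviation lcoeff :: "laurent \<Rightarrow> int \<Rightarrow> int" where
  "lcoeff \<equiv> Poly_Mapping.lookup"

definition lconst :: "int \<Rightarrow> laurent" where
  "lconst c = Poly_Mapping.single 0 c"

definition zpow :: "int \<Rightarrow> laurent" where
  "zpow e = Poly_Mapping.single e 1"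

text \<open>Substitution of \<open>z\<^sup>-\<^sup>1\<close> for \<open>z\<close>.\<close>

definition lreflect :: "laurent \<Rightarrow> laurent" where
  "lreflect P = Poly_Mapping.map_key uminus P"

lemma lcoeff_lreflect: "lcoeff (lreflect P) e = lcoeff P (- e)"
  by (simp add: lreflect_def Poly_Mapping.map_key.rep_eq)

text \<open>Unspecified for the zero Laurent polynomial.\<close>

definition ldegree :: "laurent \<Rightarrow> int" where
  "ldegree P = Max (Poly_Mapping.keys P)"

text \<open>\<open>lap_poly r s \<alpha>\<close> is \<open>\<A>\<close>, and \<open>lap_poly t s \<beta>\<close> is \<open>\<B>\<close>.\<close>

definition lap_poly :: "nat \<Rightarrow> nat \<Rightarrow> (nat \<Rightarrow> int) \<Rightarrow> laurent" where
  "lap_poly r s \<alpha> =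
     lconst (2 * int r + int s + 1) - (\<Sum>j=1..r. zpow (\<alpha> j) + zpow (- \<alpha> j))"

definition cross_poly :: "nat \<Rightarrow> (nat \<Rightarrow> int) \<Rightarrow> laurent" where
  "cross_poly s \<gamma> = - (\<Sum>j=1..s. zpow (\<gamma> j))"

section \<open>Chebyshev polynomials and the Chebyshev transform\<close>

fun cheb :: "nat \<Rightarrow> 'a::comm_ring_1 poly" where
  "cheb 0 = 1"
| "cheb (Suc 0) = [:0, 1:]"
| "cheb (Suc (Suc m)) = [:0, 2:] * cheb (Suc m) - cheb m"

lemma poly_cheb_cos:
  fixes \<theta> :: "'a::{real_normed_field, banach}"
  shows "poly (cheb m) (cos \<theta>) = cos (of_nat m * \<theta>)"
proof (induction m rule: cheb.induct)
  case (3 m)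
  let ?x = "of_nat (Suc m) * \<theta>"
  have "cos (?x + \<theta>) + cos (?x - \<theta>) = 2 * cos \<theta> * cos ?x"
    by (simp add: cos_add cos_diff)
  moreover have "?x + \<theta> = of_nat (Suc (Suc m)) * \<theta>" "?x - \<theta> = of_nat m * \<theta>"
    by (simp_all add: algebra_simps)
  ultimately have "cos (of_nat (Suc (Suc m)) * \<theta>) = 2 * cos \<theta> * cos ?x - cos (of_nat m * \<theta>)"
    by (metis add_diff_cancel_right')
  then show ?case
    using 3 by (simp add: mult.assoc mult.left_commute del: of_nat_Suc)
qed simp_all

text \<open>Intended for Laurent polynomials invariant under \<open>z \<mapsto> z\<^sup>-\<^sup>1\<close>.\<close>

definition cheb_transform :: "laurent \<Rightarrow> complex poly" where
  "cheb_transform P =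
     [:of_int (lcoeff P 0):]
     + (\<Sum>j=1..nat (ldegree P). smult (2 * of_int (lcoeff P (int j))) (cheb j))"

text \<open>\<open>w 1, \<dots>, w k\<close> are all the complex roots of \<open>p\<close>, listed with multiplicity.\<close>

definition lists_roots :: "nat \<Rightarrow> (nat \<Rightarrow> complex) \<Rightarrow> complex poly \<Rightarrow> bool" where
  "lists_roots k w p \<longleftrightarrow> image_mset w (mset_set {1..k}) = proots p"

end

theory Submission
  imports
    Defs
    "HOL-Computational_Algebra.Fundamental_Theorem_Algebra"
    "Jordan_Normal_Form.Determinant"
begin

text \<open>
  A rooted spanning forest is the same as a map sending each vertex to itself (a root) or to a
  neighbour (its parent) without creating cycles.  Expanding \<open>det (I + L)\<close>, with \<open>L\<close> the Laplacian,
  multilinearly in its rows gives one summand \<open>det (I - P\<^sub>f)\<close> for every parent map \<open>f\<close>, and this summand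
  is 1 or 0 according to whether \<open>f\<close> is free of cycles.  So \<open>det (I + L)\<close> counts rooted forests.

  For a bicirculant graph \<open>I + L\<close> consists of four circulant blocks, which the Fourier matrix
  diagonalises simultaneously; the determinant becomes the product of \<open>P\<^sub>1(z)\<close> over \<open>z\<^sup>n = 1\<close>.  If
  \<open>n = 2 h\<close>, a connection \<open>h\<close> adds \<open>1 - z\<^sup>h\<close> to a diagonal factor, which is 0 or 2; hence the product
  splits into one over \<open>z\<^sup>h = 1\<close> involving \<open>P\<^sub>1\<close> and one over \<open>z\<^sup>h = -1\<close> involving \<open>P\<^sub>2\<close>, \<open>P\<^sub>3\<close> or \<open>P\<^sub>4\<close>.  Finally \<open>P(z) = a \<Prod> (z + 1/z - 2 w\<^sub>l)\<close>, and writing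
  \<open>w = (\<zeta> + 1/\<zeta>)/2\<close> evaluates each product over roots of unity by a Chebyshev polynomial.
\<close>

section \<open>Parent maps and determinants\<close>

text \<open>Cycles of length 1 are allowed: the fixed points of a parent map are the roots.\<close>

definition acyclic_map :: "'a set \<Rightarrow> ('a \<Rightarrow> 'a) \<Rightarrow> bool" where
  "acyclic_map V f \<longleftrightarrow> (\<exists>d::'a \<Rightarrow> nat. \<forall>v\<in>V. f v \<noteq> v \<longrightarrow> d (f v) < d v)"

text \<open>A vertex of minimal height \<open>d\<close> in a nonempty \<open>S\<close> would be sent
  to a strictly lower vertex of \<open>S\<close>.\<close>

lemma acyclic_map_no_trap:
  assumes "acyclic_map V f" "S \<subseteq> V" "\<And>v. v \<in> S \<Longrightarrow> f v \<in> S \<and> f v \<noteq> v"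
  shows "S = {}"
proof (rule ccontr)
  obtain d :: "'a \<Rightarrow> nat" where d: "\<And>v. v \<in> V \<Longrightarrow> f v \<noteq> v \<Longrightarrow> d (f v) < d v"
    using assms(1) by (auto simp: acyclic_map_def)
  assume "S \<noteq> {}"
  then obtain v where "v \<in> S" "\<And>u. u \<in> S \<Longrightarrow> d v \<le> d u"
    using ex_has_least_nat[of "\<lambda>v. v \<in> S" _ d] by blast
  then show False
    using assms(2,3) d by (meson in_mono linorder_not_less)
qed

text \<open>\<open>S\<close> consists of the vertices whose orbit never meets a fixed point, so
  membership passes along \<open>f\<close> in both directions. Were \<open>S\<close> empty, the
  number of steps to a fixed point would be a height function.\<close>

lemma trap_if_not_acyclic_map:
  assumes "f \<in> V \<rightarrow> V" "\<not> acyclic_map V f"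
  obtains S where "S \<subseteq> V" "S \<noteq> {}" "\<And>v. v \<in> S \<Longrightarrow> f v \<noteq> v"
    "\<And>v. v \<in> V \<Longrightarrow> f v \<in> S \<longleftrightarrow> v \<in> S"
proof -
  define Q where "Q v k \<longleftrightarrow> f ((f ^^ k) v) = (f ^^ k) v" for v k
  have Q_shift: "Q (f v) k \<longleftrightarrow> Q v (Suc k)" for v k
    by (simp add: Q_def funpow_swap1)
  define S where "S = {v \<in> V. \<forall>k. \<not> Q v k}"
  have "S \<noteq> {}"
  proof
    assume "S = {}"
    then have ex: "\<exists>k. Q v k" if "v \<in> V" for v
      using that by (auto simp: S_def)
    have "(LEAST k. Q (f v) k) < (LEAST k. Q v k)" if "v \<in> V" "f v \<noteq> v" for v
    proof -
      have "Q v (LEAST k. Q v k)" by (rule LeastI_ex[OF ex[OF that(1)]])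
      moreover have "\<not> Q v 0" using that by (simp add: Q_def)
      ultimately obtain m where m: "(LEAST k. Q v k) = Suc m" by (metis old.nat.exhaust)
      then have "Q (f v) m"
        using \<open>Q v (LEAST k. Q v k)\<close> by (simp add: Q_shift)
      then show ?thesis using Least_le[of "Q (f v)" m] m by simp
    qed
    then have "acyclic_map V f"
      unfolding acyclic_map_def by (intro exI[of _ "\<lambda>v. LEAST k. Q v k"]) blast
    with assms(2) show False by contradiction
  qed
  moreover have "f v \<noteq> v" if "v \<in> S" for v
    using that by (auto simp: S_def Q_def dest: spec[of _ "0::nat"])
  moreover have "f v \<in> S \<longleftrightarrow> v \<in> S" if "v \<in> V" for v
  proof -
    have "Q v (Suc k)" if "Q v k" for k using that by (simp add: Q_def)
    then show ?thesis using that assms(1) Q_shift[of v] by (auto simp: S_def)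
  qed
  ultimately show ?thesis by (intro that[of S]) (auto simp: S_def)
qed

text \<open>This is \<open>I - P\<^sub>f\<close>, where \<open>P\<^sub>f\<close> has no entry in the
  row of a root: the diagonal is tested first, so a fixed point of \<open>f\<close> yields a unit
  row and not a zero row.\<close>

definition parent_matrix :: "nat \<Rightarrow> (nat \<Rightarrow> 'a) \<Rightarrow> ('a \<Rightarrow> 'a) \<Rightarrow> 'b::comm_ring_1 mat" where
  "parent_matrix N e f =
     Matrix.mat N N (\<lambda>(i, j). if e j = e i then 1 else if e j = f (e i) then - 1 else 0)"

lemma parent_matrix_carrier [simp]: "parent_matrix N e f \<in> carrier_mat N N"
  by (simp add: parent_matrix_def)

text \<open>In the Leibniz expansion only the identity survives: if the summand of another
  permutation is nonzero, that permutation sends each index it moves to the index of its parent, and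
  the moved vertices form a trap.\<close>

lemma det_parent_matrix_acyclic:
  assumes e: "bij_betw e {0..<N} V" and f: "f \<in> V \<rightarrow> V" "acyclic_map V f"
  shows "Determinant.det (parent_matrix N e f) = 1"
proof -
  let ?M = "parent_matrix N e f :: 'b mat"
  have inj: "e i = e j \<longleftrightarrow> i = j" if "i < N" "j < N" for i j
    using e that by (auto simp: bij_betw_def inj_on_def)
  have zero: "(\<Prod>i = 0..<N. ?M $$ (i, p i)) = 0" if p: "p permutes {0..<N}" "p \<noteq> id" for p
  proof (rule ccontr)
    assume nz: "(\<Prod>i = 0..<N. ?M $$ (i, p i)) \<noteq> 0"
    define S where "S = e ` {i. i < N \<and> p i \<noteq> i}"
    have pN: "p i < N" if "i < N" for i
      using permutes_in_image[OF p(1), of i] that by simp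
    have step: "e (p i) = f (e i)" if "i < N" "p i \<noteq> i" for i
    proof -
      have "?M $$ (i, p i) \<noteq> 0"
        using nz that(1) prod_zero[of "{0..<N}" "\<lambda>i. ?M $$ (i, p i)"] by fastforce
      then show ?thesis
        using that pN[OF that(1)] inj[OF pN[OF that(1)] that(1)]
        by (auto simp: parent_matrix_def split: if_splits)
    qed
    have "S \<subseteq> V" using e by (auto simp: S_def bij_betw_def)
    moreover have "f v \<in> S \<and> f v \<noteq> v" if v: "v \<in> S" for v
    proof -
      obtain i where i: "v = e i" "i < N" "p i \<noteq> i" using v by (auto simp: S_def)
      have "p (p i) \<noteq> p i" using i(3) permutes_inj[OF p(1)] by (auto dest: injD)
      then have "e (p i) \<in> S" using pN[OF i(2)] by (auto simp: S_def)
      moreover have "e (p i) \<noteq> e i" using inj[OF pN[OF i(2)] i(2)] i(3) by simp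
      ultimately show ?thesis using step[OF i(2,3)] i(1) by metis
    qed
    ultimately have "S = {}" by (rule acyclic_map_no_trap[OF f(2)])
    then have "p i = i" for i
      using permutes_not_in[OF p(1), of i] by (cases "i < N") (auto simp: S_def)
    then show False using p(2) by (auto simp: fun_eq_iff)
  qed
  have "Determinant.det ?M = (\<Sum>p | p permutes {0..<N}. signof p * (\<Prod>i = 0..<N. ?M $$ (i, p i)))"
    by (rule det_def') simp
  also have "\<dots> = (\<Sum>p\<in>{id}. signof p * (\<Prod>i = 0..<N. ?M $$ (i, p i)))"
    by (rule sum.mono_neutral_right) (auto simp: finite_permutations zero permutes_id)
  also have "\<dots> = 1" by (simp add: parent_matrix_def)
  finally show ?thesis .
qed

text \<open>The indicator vector of a trap \<open>S\<close> lies in the kernel. Row \<open>u\<close>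
  contributes 1 if \<open>u \<in> S\<close> and -1 if its parent is in \<open>S\<close>; these
  cancel because \<open>f u \<in> S\<close> exactly if \<open>u \<in> S\<close>, and roots are
  outside \<open>S\<close>.\<close>

lemma det_parent_matrix_not_acyclic:
  assumes e: "bij_betw e {0..<N} V" and f: "f \<in> V \<rightarrow> V" "\<not> acyclic_map V f"
  shows "Determinant.det (parent_matrix N e f :: 'b::idom mat) = 0"
proof -
  let ?M = "parent_matrix N e f :: 'b mat"
  obtain S where S: "S \<subseteq> V" "S \<noteq> {}" "\<And>v. v \<in> S \<Longrightarrow> f v \<noteq> v"
      "\<And>v. v \<in> V \<Longrightarrow> f v \<in> S \<longleftrightarrow> v \<in> S"
    using trap_if_not_acyclic_map[OF f] by blast
  define x :: "'b Matrix.vec" where "x = Matrix.vec N (\<lambda>j. if e j \<in> S then 1 else 0)"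
  have "finite V" using e bij_betw_finite by blast
  have "?M *\<^sub>v x = 0\<^sub>v N"
  proof (rule eq_vecI)
    fix i assume "i < dim_vec (0\<^sub>v N :: 'b Matrix.vec)"
    then have i: "i < N" by simp
    define u where "u = e i"
    have u: "u \<in> V" using e i by (auto simp: u_def bij_betw_def)
    define m :: "'a \<Rightarrow> 'b" where "m w = (if w = u then 1 else if w = f u then - 1 else 0)" for w
    have "vec_index (?M *\<^sub>v x) i = (\<Sum>j = 0..<N. m (e j) * (if e j \<in> S then 1 else 0))"
      using i by (simp add: parent_matrix_def x_def mult_mat_vec_def scalar_prod_def m_def u_def cong: if_cong)
    also have "\<dots> = (\<Sum>w\<in>V. m w * (if w \<in> S then 1 else 0))"
      by (rule sum.reindex_bij_betw[OF e])
    also have "\<dots> = (\<Sum>w\<in>S. m w)"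
      using S(1) \<open>finite V\<close> by (intro sum.mono_neutral_cong_right) auto
    also have "\<dots> = (\<Sum>w\<in>S. (if w = u then 1 else 0)) - (\<Sum>w\<in>S. (if w = f u \<and> f u \<noteq> u then 1 else 0))"
      unfolding sum_subtractf[symmetric] by (rule sum.cong) (auto simp: m_def)
    also have "\<dots> = 0"
      using S(3)[of u] S(4)[OF u] finite_subset[OF S(1) \<open>finite V\<close>]
      by (cases "f u = u") (auto simp: sum.delta)
    finally show "vec_index (?M *\<^sub>v x) i = vec_index (0\<^sub>v N) i" using i by simp
  qed (simp add: parent_matrix_def)
  moreover have "x \<noteq> 0\<^sub>v N"
  proof -
    obtain v where "v \<in> S" using S(2) by blast
    then obtain i where "i < N" "e i \<in> S" using S(1) e by (auto simp: bij_betw_def)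
    then have "vec_index x i \<noteq> vec_index (0\<^sub>v N) i" by (simp add: x_def)
    then show ?thesis by auto
  qed
  moreover have "x \<in> carrier_vec N" by (simp add: x_def)
  ultimately show ?thesis
    using det_0_iff_vec_prod_zero[OF parent_matrix_carrier] by blast
qed

text \<open>Multilinearity in the rows: row \<open>v\<close> of the matrix is the sum, over \<open>c \<in> Ch v\<close>, of the row of a
  parent matrix in which \<open>c\<close> is the parent of \<open>v\<close>.\<close>

lemma det_sum_parent_matrix:
  fixes M :: "'b::idom mat"
  assumes e: "bij_betw e {0..<N} V" and "finite V"
    and Ch: "\<And>v. v \<in> V \<Longrightarrow> v \<in> Ch v \<and> Ch v \<subseteq> V"
    and M: "M = Matrix.mat N N (\<lambda>(i, j). if i = j then of_nat (card (Ch (e i)))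
                 else if e j \<in> Ch (e i) then - 1 else 0)"
  shows "Determinant.det M = of_nat (card {f \<in> PiE V Ch. acyclic_map V f})"
proof -
  define m :: "'a \<Rightarrow> 'a \<Rightarrow> 'a \<Rightarrow> 'b" where
    "m v c w = (if w = v then 1 else if w = c then - 1 else 0)" for v c w
  define e' where "e' = inv_into {0..<N} e"
  have e': "e' (e i) = i" if "i < N" for i
    using e that by (simp add: e'_def bij_betw_def)
  have eV: "e i \<in> V" if "i < N" for i using e that by (auto simp: bij_betw_def)
  have finCh: "finite (Ch v)" if "v \<in> V" for v
    using Ch[OF that] \<open>finite V\<close> finite_subset by blast
  have inj: "e i = e j \<longleftrightarrow> i = j" if "i < N" "j < N" for i j
    using e that by (auto simp: bij_betw_def inj_on_def)
  \<comment> \<open>Each choice contributes 1 on the diagonal, which gives the cardinality; off the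
    diagonal only the choice \<open>c = e j\<close> contributes.\<close>
  have M_entry: "M $$ (i, j) = (\<Sum>c\<in>Ch (e i). m (e i) c (e j))" if "i < N" "j < N" for i j
  proof (cases "i = j")
    case False
    then have "(\<Sum>c\<in>Ch (e i). m (e i) c (e j)) = (\<Sum>c\<in>Ch (e i). if c = e j then - 1 else 0)"
      using that inj by (intro sum.cong) (auto simp: m_def)
    then show ?thesis using False that finCh[OF eV[OF that(1)]] by (simp add: M)
  qed (use that in \<open>simp add: M m_def\<close>)
  have row_prod: "(\<Prod>i = 0..<N. M $$ (i, p i))
      = (\<Sum>f\<in>PiE V Ch. \<Prod>i = 0..<N. parent_matrix N e f $$ (i, p i))"
    if p: "p permutes {0..<N}" for p
  proof -
    have pN: "p i < N" if "i < N" for i using permutes_in_image[OF p, of i] that by simp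
    \<comment> \<open>Writing \<open>i\<close> as \<open>e' (e i)\<close> makes each factor a
      function of the vertex \<open>e i\<close>. The product can then be taken over
      \<open>V\<close>, where the product of sums expands over all choice functions.\<close>
    have "(\<Prod>i = 0..<N. M $$ (i, p i)) = (\<Prod>i = 0..<N. \<Sum>c\<in>Ch (e i). m (e i) c (e (p (e' (e i)))))"
      by (intro prod.cong) (auto simp: M_entry pN e')
    also have "\<dots> = (\<Prod>v\<in>V. \<Sum>c\<in>Ch v. m v c (e (p (e' v))))"
      by (rule prod.reindex_bij_betw[OF e])
    also have "\<dots> = (\<Sum>f\<in>PiE V Ch. \<Prod>v\<in>V. m v (f v) (e (p (e' v))))"
      by (rule prod_sum_PiE) (use \<open>finite V\<close> finCh in auto)
    also have "\<dots> = (\<Sum>f\<in>PiE V Ch. \<Prod>i = 0..<N. m (e i) (f (e i)) (e (p (e' (e i)))))"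
      by (subst prod.reindex_bij_betw[OF e]) (rule refl)
    also have "\<dots> = (\<Sum>f\<in>PiE V Ch. \<Prod>i = 0..<N. parent_matrix N e f $$ (i, p i))"
      by (intro sum.cong prod.cong) (auto simp: parent_matrix_def m_def pN e')
    finally show ?thesis .
  qed
  have "Determinant.det M = (\<Sum>p | p permutes {0..<N}. signof p * (\<Prod>i = 0..<N. M $$ (i, p i)))"
    by (rule det_def') (simp add: M)
  also have "\<dots> = (\<Sum>p | p permutes {0..<N}. \<Sum>f\<in>PiE V Ch.
      signof p * (\<Prod>i = 0..<N. parent_matrix N e f $$ (i, p i)))"
    by (intro sum.cong) (auto simp: row_prod sum_distrib_left)
  also have "\<dots> = (\<Sum>f\<in>PiE V Ch. Determinant.det (parent_matrix N e f))"
    by (subst sum.swap, subst det_def'[OF parent_matrix_carrier]) (rule refl)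
  also have "\<dots> = (\<Sum>f\<in>PiE V Ch. if acyclic_map V f then 1 else 0)"
  proof (rule sum.cong[OF refl])
    fix f assume "f \<in> PiE V Ch"
    then have "f \<in> V \<rightarrow> V" using Ch by (fastforce simp: PiE_def Pi_def)
    then show "Determinant.det (parent_matrix N e f) = (if acyclic_map V f then 1 else (0::'b))"
      using det_parent_matrix_acyclic[OF e] det_parent_matrix_not_acyclic[OF e] by auto
  qed
  also have "\<dots> = of_nat (card {f \<in> PiE V Ch. acyclic_map V f})"
    using finite_PiE[of V Ch] \<open>finite V\<close> finCh by (simp add: sum.If_cases Int_def)
  finally show ?thesis .
qed

section \<open>The matrix-tree theorem for rooted forests\<close>

text \<open>The path is built from its end. If the vertex to be prepended already occurs on it, the
  part before that occurrence is cut off instead.\<close>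

lemma distinct_path_if_rtrancl:
  assumes "(u, v) \<in> r\<^sup>*"
  obtains vs where "vs \<noteq> []" "hd vs = u" "last vs = v" "distinct vs"
    "successively (\<lambda>x y. (x, y) \<in> r) vs" "set vs \<subseteq> insert u (Range r)"
proof -
  have "\<exists>vs. vs \<noteq> [] \<and> hd vs = u \<and> last vs = v \<and> distinct vs
      \<and> successively (\<lambda>x y. (x, y) \<in> r) vs \<and> set vs \<subseteq> insert u (Range r)"
    using assms
  proof (induction rule: converse_rtrancl_induct)
    case base
    show ?case by (intro exI[of _ "[v]"]) simp
  next
    case (step y z)
    then obtain vs where vs: "vs \<noteq> []" "hd vs = z" "last vs = v" "distinct vs"
      "successively (\<lambda>x y. (x, y) \<in> r) vs" "set vs \<subseteq> insert z (Range r)" by blast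
    show ?case
    proof (cases "y \<in> set vs")
      case True
      then obtain as bs where "vs = as @ y # bs" by (meson split_list)
      moreover have "set vs \<subseteq> Range r" using vs(6) step.hyps(1) by auto
      ultimately show ?thesis
        using vs by (intro exI[of _ "y # bs"]) (auto simp: successively_append_iff)
    next
      case False
      then show ?thesis
        using vs step.hyps(1)
        by (intro exI[of _ "y # vs"]) (auto simp: successively_Cons)
    qed
  qed
  then show ?thesis using that by blast
qed

text \<open>A simple path in \<open>F'\<close> from \<open>u\<close> to \<open>v\<close> is closed
  by the edge \<open>{u, v}\<close>. It has at least three vertices, for a path with two would
  consist of the edge \<open>{u, v}\<close>, which is not in \<open>F'\<close>.\<close>

lemma ucycle_if_connected_without_edge:
  assumes "(u, v) \<in> {(x, y). {x, y} \<in> F'}\<^sup>*" "F' \<subseteq> uedges G" "{u, v} \<in> uedges G" "{u, v} \<notin> F'" "u \<noteq> v"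
    and "\<And>x y. {x, y} \<in> uedges G \<Longrightarrow> x \<in> uverts G"
  shows "\<exists>vs. ucycle G vs"
proof -
  obtain vs where vs: "vs \<noteq> []" "hd vs = u" "last vs = v" "distinct vs"
    "successively (\<lambda>x y. (x, y) \<in> {(x, y). {x, y} \<in> F'}) vs"
    "set vs \<subseteq> insert u (Range {(x, y). {x, y} \<in> F'})"
    using distinct_path_if_rtrancl[OF assms(1)] by blast
  have "length vs \<ge> 3"
  proof (rule ccontr)
    assume "\<not> length vs \<ge> 3"
    then consider x where "vs = [x]" | x y where "vs = [x, y]"
      using vs(1) by (cases vs; cases "tl vs"; cases "tl (tl vs)") auto
    then show False using vs assms(4,5) by cases auto
  qed
  moreover have "successively (\<lambda>x y. {x, y} \<in> uedges G) vs"
    using vs(5) by (rule successively_mono) (use assms(2) in auto)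
  moreover have "set vs \<subseteq> uverts G"
    using vs(6) assms(2,3,6) by (fastforce simp: insert_commute)
  ultimately show ?thesis
    using vs assms(3) by (auto simp: ucycle_def insert_commute)
qed

definition parent_edges :: "'a set \<Rightarrow> ('a \<Rightarrow> 'a) \<Rightarrow> 'a set set" where
  "parent_edges V f = {{v, f v} | v. v \<in> V \<and> f v \<noteq> v}"

definition fixed_points :: "'a set \<Rightarrow> ('a \<Rightarrow> 'a) \<Rightarrow> 'a set" where
  "fixed_points V f = {v \<in> V. f v = v}"

section \<open>Correspondence between parent maps and rooted spanning forests\<close>

locale simple_ugraph =
  fixes G :: "'a ugraph" and V E
  assumes fin: "finite V"
    and V_def: "uverts G = V" and E_def: "uedges G = E"
    and edge_ends: "\<And>x y. {x, y} \<in> E \<Longrightarrow> x \<in> V \<and> x \<noteq> y"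
    and edge_pair: "\<And>e. e \<in> E \<Longrightarrow> \<exists>x y. e = {x, y}"
begin

text \<open>Choosing \<open>v\<close> itself declares \<open>v\<close> a root.\<close>

definition choices :: "'a \<Rightarrow> 'a set" where
  "choices v = insert v {w. {v, w} \<in> E}"

abbreviation parent_maps :: "('a \<Rightarrow> 'a) set" where
  "parent_maps \<equiv> {f \<in> PiE V choices. acyclic_map V f}"

lemma choices_subset: "v \<in> V \<Longrightarrow> v \<in> choices v \<and> choices v \<subseteq> V"
  using edge_ends by (fastforce simp: choices_def insert_commute)

lemma parent_map_in: "f \<in> parent_maps \<Longrightarrow> v \<in> V \<Longrightarrow> f v \<in> V"
  using choices_subset by (auto simp: PiE_iff)

lemma parent_edges_subset: "f \<in> parent_maps \<Longrightarrow> parent_edges V f \<subseteq> E"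
  by (auto simp: parent_edges_def choices_def PiE_iff)

text \<open>At a vertex of maximal height on a cycle, both incident cycle edges lead to vertices
  that are not higher, hence to the parent. The two cycle neighbours would then coincide.\<close>

lemma uacyclic_parent_edges:
  assumes f: "f \<in> parent_maps"
  shows "uacyclic (G\<lparr>uedges := parent_edges V f\<rparr>)"
proof -
  obtain d :: "'a \<Rightarrow> nat" where d: "\<And>v. v \<in> V \<Longrightarrow> f v \<noteq> v \<Longrightarrow> d (f v) < d v"
    using f by (auto simp: acyclic_map_def)
  have up: "y = f x" if "{x, y} \<in> parent_edges V f" "d y \<le> d x" for x y
    using that d by (auto simp: parent_edges_def doubleton_eq_iff dest: leD)
  have False if c: "ucycle (G\<lparr>uedges := parent_edges V f\<rparr>) vs" for vs
  proof -
    have vs: "length vs \<ge> 3" "distinct vs"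
      "successively (\<lambda>x y. {x, y} \<in> parent_edges V f) vs" "{last vs, hd vs} \<in> parent_edges V f"
      using c by (auto simp: ucycle_def)
    let ?n = "length vs"
    \<comment> \<open>Cyclic successor and predecessor; for every index they differ, because the
      cycle has at least three vertices.\<close>
    define nxt where "nxt i = (if Suc i = ?n then 0 else Suc i)" for i
    define prv where "prv i = (if i = 0 then ?n - 1 else i - 1)" for i
    have edge: "{vs ! i, vs ! nxt i} \<in> parent_edges V f" if "i < ?n" for i
    proof (cases "Suc i = ?n")
      case True
      then have "vs ! i = last vs" "vs ! nxt i = hd vs"
        using vs(1) by (auto simp: last_conv_nth hd_conv_nth nxt_def simp flip: True length_0_conv)
      then show ?thesis using vs(4) by simp
    next
      case False
      then show ?thesis using vs(3) that by (auto simp: nxt_def successively_conv_nth)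
    qed
    obtain i where i: "i < ?n" "\<And>j. j < ?n \<Longrightarrow> d (vs ! j) \<le> d (vs ! i)"
    proof -
      let ?M = "Max ((\<lambda>i. d (vs ! i)) ` {..<?n})"
      have "?M \<in> (\<lambda>i. d (vs ! i)) ` {..<?n}" using vs(1) by (intro Max_in) (auto simp: lessThan_empty_iff)
      then obtain i where "i < ?n" "?M = d (vs ! i)" by auto
      then show ?thesis using that Max_ge[of "(\<lambda>i. d (vs ! i)) ` {..<?n}"] by (metis finite_imageI finite_lessThan imageI lessThan_iff)
    qed
    have lt: "nxt i < ?n" "prv i < ?n" and ne: "nxt i \<noteq> prv i" and np: "nxt (prv i) = i"
      using vs(1) i(1) by (auto simp: nxt_def prv_def)
    have "vs ! nxt i = f (vs ! i)" using up edge[OF i(1)] i(2)[OF lt(1)] by blast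
    moreover have "vs ! prv i = f (vs ! i)"
      using up[of "vs ! i" "vs ! prv i"] edge[OF lt(2)] i(2)[OF lt(2)] by (simp add: np insert_commute)
    ultimately show False using vs(2) lt ne by (metis nth_eq_iff_index_eq)
  qed
  then show ?thesis by (auto simp: uacyclic_def)
qed

text \<open>Each proper step lowers the height, so \<open>f\<close> iterated as often as the largest
  height sends every vertex to the root above it.\<close>

lemma parent_map_reaches_root:
  assumes f: "f \<in> parent_maps"
  obtains \<rho> where "\<And>v. v \<in> V \<Longrightarrow> \<rho> v \<in> fixed_points V f"
    "\<And>v. v \<in> V \<Longrightarrow> (v, \<rho> v) \<in> {(x, y). {x, y} \<in> parent_edges V f}\<^sup>*"
    "\<And>v. v \<in> V \<Longrightarrow> \<rho> (f v) = \<rho> v" "\<And>v. v \<in> fixed_points V f \<Longrightarrow> \<rho> v = v"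
proof -
  obtain d :: "'a \<Rightarrow> nat" where d: "\<And>v. v \<in> V \<Longrightarrow> f v \<noteq> v \<Longrightarrow> d (f v) < d v"
    using f by (auto simp: acyclic_map_def)
  \<comment> \<open>Inserting 0 keeps the maximum meaningful if \<open>V\<close> is empty.\<close>
  define K where "K = Max (insert 0 (d ` V))"
  have K: "d v \<le> K" if "v \<in> V" for v using that fin by (simp add: K_def)
  have V: "(f ^^ k) v \<in> V" if "v \<in> V" for k v
    by (induction k) (use that parent_map_in[OF f] in auto)
  have fix_step: "f ((f ^^ k) v) = (f ^^ k) v" if "v \<in> V" "d v \<le> k" for k v
    using that
  proof (induction k arbitrary: v)
    case 0
    then show ?case using d[of v] by force
  next
    case (Suc k)
    show ?case
    proof (cases "f v = v")
      case True
      then have "(f ^^ k) v = v" for k by (induction k) auto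
      then show ?thesis using True by simp
    next
      case False
      then show ?thesis
        using Suc.IH[of "f v"] d[OF Suc.prems(1)] Suc.prems parent_map_in[OF f]
        by (simp add: funpow_swap1)
    qed
  qed
  have "(v, (f ^^ k) v) \<in> {(x, y). {x, y} \<in> parent_edges V f}\<^sup>*" if "v \<in> V" for v k
  proof (induction k)
    case (Suc k)
    show ?case
    proof (cases "f ((f ^^ k) v) = (f ^^ k) v")
      case False
      then have "((f ^^ k) v, (f ^^ Suc k) v) \<in> {(x, y). {x, y} \<in> parent_edges V f}"
        using V[OF that] by (auto simp: parent_edges_def)
      then show ?thesis using Suc by (meson rtrancl.rtrancl_into_rtrancl)
    qed (use Suc in auto)
  qed simp
  moreover have "(f ^^ K) v = v" if "f v = v" for v
    by (induction K) (use that in auto)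
  ultimately show ?thesis
    using fix_step V K by (intro that[of "f ^^ K"]) (auto simp: fixed_points_def simp flip: funpow_swap1)
qed

lemma uadj_update: "uadj (G\<lparr>uedges := F\<rparr>) = {(x, y). {x, y} \<in> F}"
  by (simp add: uadj_def)

text \<open>The components are the reachability classes of the vertices, so the condition on
  components can be tested vertex by vertex.\<close>

lemma rooted_spanning_forests_iff:
  "(F, X) \<in> rooted_spanning_forests G \<longleftrightarrow>
     F \<subseteq> E \<and> uacyclic (G\<lparr>uedges := F\<rparr>) \<and> X \<subseteq> V
       \<and> (\<forall>v\<in>V. \<exists>!x. x \<in> X \<and> (v, x) \<in> {(x, y). {x, y} \<in> F}\<^sup>*)"
proof -
  have "(\<forall>C\<in>ucomponents (G\<lparr>uedges := F\<rparr>). \<exists>!x. x \<in> C \<and> x \<in> X)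
      \<longleftrightarrow> (\<forall>v\<in>V. \<exists>!x. x \<in> X \<and> (v, x) \<in> {(x, y). {x, y} \<in> F}\<^sup>*)" if "X \<subseteq> V"
  proof -
    have "x \<in> ureach (G\<lparr>uedges := F\<rparr>) `` {v} \<and> x \<in> X \<longleftrightarrow> x \<in> X \<and> (v, x) \<in> {(x, y). {x, y} \<in> F}\<^sup>*"
      if "v \<in> V" for v x
      using that \<open>X \<subseteq> V\<close> by (auto simp: ureach_def uadj_update V_def)
    then show ?thesis
      unfolding ucomponents_def quotient_def by (auto simp: V_def)
  qed
  then show ?thesis
    unfolding rooted_spanning_forests_def by (simp add: V_def E_def cong: conj_cong)
qed

text \<open>The root map \<open>\<rho>\<close> is constant along parent edges, hence on components,
  and it fixes every fixed point of \<open>f\<close>. So \<open>\<rho> v\<close> is the only root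
  that can be reached from \<open>v\<close>.\<close>

lemma parent_map_forest:
  assumes f: "f \<in> parent_maps"
  shows "(parent_edges V f, fixed_points V f) \<in> rooted_spanning_forests G"
proof -
  obtain \<rho> where \<rho>: "\<And>v. v \<in> V \<Longrightarrow> \<rho> v \<in> fixed_points V f"
    "\<And>v. v \<in> V \<Longrightarrow> (v, \<rho> v) \<in> {(x, y). {x, y} \<in> parent_edges V f}\<^sup>*"
    "\<And>v. v \<in> V \<Longrightarrow> \<rho> (f v) = \<rho> v" "\<And>v. v \<in> fixed_points V f \<Longrightarrow> \<rho> v = v"
    using parent_map_reaches_root[OF f] by blast
  have edge: "\<rho> x = \<rho> y" if "{x, y} \<in> parent_edges V f" for x y
    using that \<rho>(3) by (auto simp: parent_edges_def doubleton_eq_iff)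
  have "\<rho> x = \<rho> y" if "(x, y) \<in> {(x, y). {x, y} \<in> parent_edges V f}\<^sup>*" for x y
    using that by (induction rule: rtrancl_induct) (auto dest: edge)
  then have "\<exists>!x. x \<in> fixed_points V f \<and> (v, x) \<in> {(x, y). {x, y} \<in> parent_edges V f}\<^sup>*" if "v \<in> V" for v
    using \<rho> that by (intro ex1I[of _ "\<rho> v"]) force+
  then show ?thesis
    using uacyclic_parent_edges[OF f] parent_edges_subset[OF f]
    by (simp add: rooted_spanning_forests_iff fixed_points_def)
qed

lemma inj_on_parent_maps:
  "inj_on (\<lambda>f. (parent_edges V f, fixed_points V f)) parent_maps"
proof (rule inj_onI)
  fix f g assume f: "f \<in> parent_maps" and g: "g \<in> parent_maps"
    and "(parent_edges V f, fixed_points V f) = (parent_edges V g, fixed_points V g)"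
  then have eq: "parent_edges V f = parent_edges V g" "fixed_points V f = fixed_points V g" by auto
  \<comment> \<open>If \<open>f\<close> and \<open>g\<close> differ at \<open>v\<close>, then the edge to \<open>f v\<close> is used by \<open>g\<close> in the opposite direction, so they
    differ at \<open>f v\<close> as well.\<close>
  define D where "D = {v \<in> V. f v \<noteq> g v}"
  have "f v \<in> D \<and> f v \<noteq> v" if v: "v \<in> D" for v
  proof -
    have "v \<in> V" and ne: "f v \<noteq> g v" using v by (auto simp: D_def)
    have nf: "f v \<noteq> v"
    proof
      assume "f v = v"
      then have "v \<in> fixed_points V g" using \<open>v \<in> V\<close> eq(2) by (auto simp: fixed_points_def)
      then show False using \<open>f v = v\<close> ne by (simp add: fixed_points_def)
    qed
    then have "{v, f v} \<in> parent_edges V g"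
      using eq(1) \<open>v \<in> V\<close> by (auto simp: parent_edges_def)
    then have gf: "g (f v) = v" using ne by (auto simp: parent_edges_def doubleton_eq_iff)
    \<comment> \<open>Otherwise \<open>{v, f v}\<close> would be a trap for \<open>f\<close>. Since
      \<open>g (f v) = v\<close>, this makes \<open>f\<close> and \<open>g\<close> differ at
      \<open>f v\<close>.\<close>
    have "f (f v) \<noteq> v"
    proof
      assume "f (f v) = v"
      then have "{v, f v} = {}"
        using nf \<open>v \<in> V\<close> parent_map_in[OF f] f by (intro acyclic_map_no_trap[of V f]) auto
      then show False by simp
    qed
    then show ?thesis using gf nf parent_map_in[OF f \<open>v \<in> V\<close>] by (simp add: D_def)
  qed
  then have "D = {}" using f by (intro acyclic_map_no_trap[of V f]) (auto simp: D_def)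
  then show "f = g"
    using f g by (intro PiE_ext[of f V choices g]) (auto simp: D_def)
qed

text \<open>Each vertex outside \<open>X\<close> takes as parent a neighbour in \<open>F\<close>
  that is closer to \<open>X\<close>; the distance \<open>d\<close> is the height. An edge of
  \<open>F\<close> that is not a parent edge would join two vertices already connected by parent
  edges through their common root, and so would close a cycle.\<close>

lemma forest_parent_map:
  assumes "(F, X) \<in> rooted_spanning_forests G"
  shows "\<exists>f\<in>parent_maps. F = parent_edges V f \<and> X = fixed_points V f"
proof -
  define r where "r = {(x, y). {x, y} \<in> F}"
  have forest: "F \<subseteq> E \<and> uacyclic (G\<lparr>uedges := F\<rparr>) \<and> X \<subseteq> V \<and> (\<forall>v\<in>V. \<exists>!x. x \<in> X \<and> (v, x) \<in> r\<^sup>*)"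
    using assms unfolding rooted_spanning_forests_iff r_def .
  note F = forest[THEN conjunct1] forest[THEN conjunct2, THEN conjunct1]
  note X = forest[THEN conjunct2, THEN conjunct2, THEN conjunct1]
  note root = forest[THEN conjunct2, THEN conjunct2, THEN conjunct2, rule_format]
  have ends: "x \<in> V" "y \<in> V" "x \<noteq> y" if "{x, y} \<in> F" for x y
    using that F(1) edge_ends[of x y] edge_ends[of y x] by (auto simp: insert_commute)
  define reach where "reach v k \<longleftrightarrow> (\<exists>x\<in>X. (v, x) \<in> r ^^ k)" for v k
  define d where "d v = (LEAST k. reach v k)" for v
  have d: "reach v (d v)" if "v \<in> V" for v
  proof -
    obtain x where "x \<in> X" "(v, x) \<in> r\<^sup>*" using root[OF \<open>v \<in> V\<close>] by blast
    then have "\<exists>k. reach v k" by (auto simp: reach_def rtrancl_power)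
    then show ?thesis unfolding d_def by (rule LeastI_ex)
  qed
  have parent: "\<exists>w. {v, w} \<in> F \<and> d w < d v" if "v \<in> V" "v \<notin> X" for v
  proof -
    have "d v \<noteq> 0" using d[OF that(1)] that(2) by (cases "d v") (auto simp: reach_def)
    then obtain k where k: "d v = Suc k" by (cases "d v") auto
    then obtain x w where "x \<in> X" "(v, w) \<in> r" "(w, x) \<in> r ^^ k"
      using d[OF \<open>v \<in> V\<close>] unfolding reach_def k by (meson relpow_Suc_D2)
    then have "reach w k" "{v, w} \<in> F" by (auto simp: reach_def r_def)
    then show ?thesis using k Least_le[of "reach w" k] by (auto simp: d_def)
  qed
  \<comment> \<open>The restriction to \<open>V\<close> makes \<open>f\<close> extensional, as
    membership in \<open>PiE\<close> requires.\<close>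
  define f where "f = (\<lambda>v\<in>V. if v \<in> X then v else SOME w. {v, w} \<in> F \<and> d w < d v)"
  have fX: "f v = v" if "v \<in> X" for v using that X by (auto simp: f_def)
  have f: "{v, f v} \<in> F" "d (f v) < d v" if "v \<in> V" "v \<notin> X" for v
    using someI_ex[OF parent[OF that]] that by (auto simp: f_def)
  have "f v \<in> choices v" if "v \<in> V" for v
    using fX[of v] f[OF that] F(1) by (cases "v \<in> X") (auto simp: choices_def)
  moreover have "acyclic_map V f"
    unfolding acyclic_map_def using fX f by (intro exI[of _ d]) blast
  ultimately have pm: "f \<in> parent_maps" by (auto simp: PiE_iff f_def)
  have "f v \<noteq> v" if "v \<in> V" "v \<notin> X" for v
    using f(2)[OF that] by auto
  then have fp: "fixed_points V f = X"
    using X fX unfolding fixed_points_def by blast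
  have sub: "parent_edges V f \<subseteq> F"
    unfolding parent_edges_def using f(1) fX by blast
  obtain \<rho> where \<rho>: "\<And>v. v \<in> V \<Longrightarrow> \<rho> v \<in> fixed_points V f"
    "\<And>v. v \<in> V \<Longrightarrow> (v, \<rho> v) \<in> {(x, y). {x, y} \<in> parent_edges V f}\<^sup>*"
    "\<And>v. v \<in> V \<Longrightarrow> \<rho> (f v) = \<rho> v" "\<And>v. v \<in> fixed_points V f \<Longrightarrow> \<rho> v = v"
    using parent_map_reaches_root[OF pm] by blast
  have sym: "sym ({(x, y). {x, y} \<in> parent_edges V f}\<^sup>*)"
    by (rule sym_rtrancl, rule symI) (simp add: insert_commute)
  have mono: "{(x, y). {x, y} \<in> parent_edges V f}\<^sup>* \<subseteq> r\<^sup>*"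
    using sub by (intro rtrancl_mono) (auto simp: r_def)
  have "e \<in> parent_edges V f" if e: "e \<in> F" for e
  proof (rule ccontr)
    assume ne: "e \<notin> parent_edges V f"
    obtain u v where uv: "e = {u, v}" using edge_pair F(1) e by blast
    then have V: "u \<in> V" "v \<in> V" "u \<noteq> v" using ends e by auto
    have "(u, v) \<in> r" using e uv by (simp add: r_def)
    moreover have "(v, \<rho> v) \<in> r\<^sup>*" "(u, \<rho> u) \<in> r\<^sup>*"
      using subsetD[OF mono \<rho>(2)] V by blast+
    ultimately have "(u, \<rho> v) \<in> r\<^sup>*" "(u, \<rho> u) \<in> r\<^sup>*"
      by (auto intro: converse_rtrancl_into_rtrancl)
    moreover have "\<rho> u \<in> X" "\<rho> v \<in> X" using \<rho>(1) V fp by auto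
    ultimately have "\<rho> u = \<rho> v" using root[OF V(1)] by (elim ex1E) blast
    then have "(u, v) \<in> {(x, y). {x, y} \<in> parent_edges V f}\<^sup>*"
      using \<rho>(2)[OF V(1)] symD[OF sym \<rho>(2)[OF V(2)]] by simp
    then have "\<exists>vs. ucycle (G\<lparr>uedges := F\<rparr>) vs"
    proof (rule ucycle_if_connected_without_edge)
      show "x \<in> uverts (G\<lparr>uedges := F\<rparr>)" if "{x, y} \<in> uedges (G\<lparr>uedges := F\<rparr>)" for x y
        using ends(1)[of x y] that by (simp add: V_def)
    qed (use sub e uv ne V(3) in simp_all)
    then show False using F(2) by (simp add: uacyclic_def)
  qed
  with sub have "F = parent_edges V f" by blast
  with pm fp show ?thesis by (intro bexI[of _ f]) simp_all
qed

theorem num_rooted_spanning_forests_eq_card: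
  "num_rooted_spanning_forests G = card parent_maps"
proof -
  have "rooted_spanning_forests G = (\<lambda>f. (parent_edges V f, fixed_points V f)) ` parent_maps"
  proof (rule subset_antisym; rule subsetI)
    fix FX assume "FX \<in> rooted_spanning_forests G"
    then show "FX \<in> (\<lambda>f. (parent_edges V f, fixed_points V f)) ` parent_maps"
      using forest_parent_map[of "fst FX" "snd FX"] by (metis (lifting) image_eqI prod.collapse)
  next
    fix FX assume "FX \<in> (\<lambda>f. (parent_edges V f, fixed_points V f)) ` parent_maps"
    then show "FX \<in> rooted_spanning_forests G"
      using parent_map_forest by (metis (lifting) imageE)
  qed
  then show ?thesis
    using card_image[OF inj_on_parent_maps] by (simp add: num_rooted_spanning_forests_def)
qed

text \<open>The matrix is \<open>I + L\<close>. Its diagonal entry, 1 plus the degree, is the number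
  of choices of the vertex, which is the form that \<open>det_sum_parent_matrix\<close>
  expects.\<close>

theorem rooted_forest_matrix_tree:
  assumes "bij_betw e {0..<N} V"
  shows "of_nat (num_rooted_spanning_forests G) = Determinant.det (Matrix.mat N N (\<lambda>(i, j).
      if i = j then 1 + of_nat (card {w. {e i, w} \<in> E}) else if {e i, e j} \<in> E then - 1 else (0::'b::idom)))"
    (is "_ = Determinant.det ?M")
proof -
  have "e i \<in> V" if "i < N" for i using assms that by (auto simp: bij_betw_def)
  moreover have "e i = e j \<longleftrightarrow> i = j" if "i < N" "j < N" for i j
    using assms that by (auto simp: bij_betw_def inj_on_def)
  moreover have "card (choices v) = Suc (card {w. {v, w} \<in> E})" if "v \<in> V" for v
  proof -
    have "{w. {v, w} \<in> E} \<subseteq> V" "v \<notin> {w. {v, w} \<in> E}"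
      using edge_ends by (fastforce simp: insert_commute)+
    then show ?thesis using finite_subset[OF _ fin] by (simp add: choices_def)
  qed
  ultimately have "?M = Matrix.mat N N (\<lambda>(i, j). if i = j then of_nat (card (choices (e i)))
                 else if e j \<in> choices (e i) then - 1 else 0)"
    by (intro eq_matI) (auto simp: choices_def)
  from det_sum_parent_matrix[OF assms fin choices_subset this] show ?thesis
    by (simp add: num_rooted_spanning_forests_eq_card)
qed

end

section \<open>Block circulant determinants\<close>

lemma bij_betw_add_mod:
  assumes "n > (0::int)"
  shows "bij_betw (\<lambda>x. (x + c) mod n) {0..<n} {0..<n}"
  by (rule bij_betw_byWitness[where f' = "\<lambda>y. (y - c) mod n"])
     (use assms in \<open>auto simp: mod_simps\<close>)

lemma bij_betw_diff_mod:
  assumes "n > (0::int)"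
  shows "bij_betw (\<lambda>x. (c - x) mod n) {0..<n} {0..<n}"
  by (rule bij_betw_byWitness[where f' = "\<lambda>y. (c - y) mod n"])
     (use assms in \<open>auto simp: mod_simps\<close>)

lemma power_int_mod_root_of_unity:
  fixes z :: "'a::field"
  assumes "n > 0" "z ^ n = 1"
  shows "z powi (e mod int n) = z powi e"
proof -
  have "z \<noteq> 0" using assms by (auto simp: zero_power)
  have "z powi e = z powi (int n * (e div int n) + e mod int n)" by simp
  also have "\<dots> = (z powi int n) powi (e div int n) * z powi (e mod int n)"
    using \<open>z \<noteq> 0\<close> power_int_add[of z "int n * (e div int n)" "e mod int n"] by (simp only: power_int_mult) simp
  finally show ?thesis using assms by simp
qed

section \<open>Circulant matrices and their eigenvalues\<close>

definition circulant :: "nat \<Rightarrow> (int \<Rightarrow> 'a) \<Rightarrow> 'a mat" where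
  "circulant n a = Matrix.mat n n (\<lambda>(i, j). a ((int j - int i) mod int n))"

text \<open>If \<open>z ^ n = 1\<close>, this is the eigenvalue of \<open>circulant n a\<close> at
  the vector of powers of \<open>z\<close>.\<close>

definition symbol :: "nat \<Rightarrow> (int \<Rightarrow> 'a::field) \<Rightarrow> 'a \<Rightarrow> 'a" where
  "symbol n a z = (\<Sum>x\<in>{0..<int n}. a x * z powi x)"

lemma circulant_carrier [simp]: "circulant n a \<in> carrier_mat n n"
  by (simp add: circulant_def)

lemma sum_nat_to_int: "(\<Sum>l = 0..<n. g (int l)) = (\<Sum>x\<in>{0..<int n}. g x)"
  by (rule sum.reindex_bij_betw)
     (auto simp: bij_betw_def inj_on_def image_int_atLeastLessThan)

text \<open>Each entry of the product is a cyclic convolution, and substituting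
  \<open>i + j - x\<close> for \<open>x\<close> modulo \<open>n\<close> exchanges the two
  factors.\<close>

lemma circulant_mult_commute:
  fixes a b :: "int \<Rightarrow> 'a::comm_ring_1"
  shows "circulant n a * circulant n b = circulant n b * circulant n a"
proof (rule eq_matI)
  fix i j assume "i < dim_row (circulant n b * circulant n a)" "j < dim_col (circulant n b * circulant n a)"
  then have ij: "i < n" "j < n" by (auto simp: circulant_def)
  have entry: "(circulant n a * circulant n b) $$ (i, j)
      = (\<Sum>x\<in>{0..<int n}. a ((x - int i) mod int n) * b ((int j - x) mod int n))" for a b :: "int \<Rightarrow> 'a"
    using ij by (subst sum_nat_to_int[symmetric]) (simp add: circulant_def scalar_prod_def)
  have "(\<Sum>x\<in>{0..<int n}. a ((x - int i) mod int n) * b ((int j - x) mod int n))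
      = (\<Sum>x\<in>{0..<int n}. a (((int i + int j - x) mod int n - int i) mod int n)
          * b ((int j - (int i + int j - x) mod int n) mod int n))"
    by (rule sum.reindex_bij_betw[symmetric, OF bij_betw_diff_mod]) (use ij in auto)
  also have "\<dots> = (\<Sum>x\<in>{0..<int n}. b ((x - int i) mod int n) * a ((int j - x) mod int n))"
    by (intro sum.cong) (auto simp: mod_simps mult.commute)
  finally show "(circulant n a * circulant n b) $$ (i, j) = (circulant n b * circulant n a) $$ (i, j)"
    by (simp add: entry)
qed (auto simp: circulant_def)

text \<open>Powers of \<open>z\<close> depend on the exponent modulo \<open>n\<close> only, so
  \<open>z ^ l\<close> splits into \<open>z ^ i\<close> and a power at the residue of
  \<open>l - i\<close>; shifting the summation index by \<open>i\<close> then gives the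
  symbol.\<close>

lemma circulant_eigen:
  fixes z :: "'a::field"
  assumes "n > 0" "z ^ n = 1" "i < n"
  shows "(\<Sum>l = 0..<n. a ((int l - int i) mod int n) * z ^ l) = z ^ i * symbol n a z"
proof -
  have "z \<noteq> 0" using assms by (auto simp: zero_power)
  have "(\<Sum>l = 0..<n. a ((int l - int i) mod int n) * z ^ l)
      = (\<Sum>l = 0..<n. a ((int l - int i) mod int n) * (z ^ i * z powi ((int l - int i) mod int n)))"
    using \<open>z \<noteq> 0\<close> by (intro sum.cong) (auto simp: power_int_mod_root_of_unity[OF assms(1,2)] power_int_diff)
  also have "\<dots> = (\<Sum>x\<in>{0..<int n}. a ((x + - int i) mod int n) * (z ^ i * z powi ((x + - int i) mod int n)))"
    by (subst sum_nat_to_int[symmetric]) simp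
  also have "\<dots> = (\<Sum>x\<in>{0..<int n}. a x * (z ^ i * z powi x))"
    by (rule sum.reindex_bij_betw[OF bij_betw_add_mod]) (use assms in auto)
  also have "\<dots> = z ^ i * symbol n a z"
    by (simp add: symbol_def sum_distrib_left mult_ac)
  finally show ?thesis .
qed

lemma det_mat_diag: "Determinant.det (mat_diag n f) = (\<Prod>i = 0..<n. f i)"
  by (subst det_upper_triangular[of _ n])
     (auto simp: mat_diag_def upper_triangular_def prod_list_diag_prod)

section \<open>Simultaneous diagonalisation by the Fourier matrix\<close>

context
  fixes n :: nat and \<omega> :: "nat \<Rightarrow> complex"
  assumes n: "n > 0" and \<omega>: "bij_betw \<omega> {0..<n} {z. z ^ n = 1}"
begin

definition fourier :: "complex mat" where
  "fourier = Matrix.mat n n (\<lambda>(i, j). \<omega> j ^ i)"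

lemma fourier_carrier [simp]: "fourier \<in> carrier_mat n n"
  by (simp add: fourier_def)

lemma \<omega>_root: "j < n \<Longrightarrow> \<omega> j ^ n = 1"
  using \<omega> by (auto simp: bij_betw_def)

lemma circulant_mult_fourier:
  "circulant n a * fourier = fourier * mat_diag n (\<lambda>j. symbol n a (\<omega> j))"
  by (subst mat_diag_mult_right[of _ n], simp, rule eq_matI)
     (auto simp: fourier_def circulant_def scalar_prod_def circulant_eigen[OF n \<omega>_root])

text \<open>The columns are orthogonal: the product with the matrix of inverse powers is
  \<open>n\<close> times the identity, since the geometric sum of an \<open>n\<close>-th root of
  unity other than 1 vanishes.\<close>

lemma det_fourier_nonzero: "Determinant.det fourier \<noteq> 0"
proof -
  let ?F' = "Matrix.mat n n (\<lambda>(i, j). inverse (\<omega> i) ^ j)"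
  have "?F' * fourier = mat_diag n (\<lambda>_. of_nat n)"
  proof (rule eq_matI)
    fix i j assume "i < dim_row (mat_diag n (\<lambda>_. of_nat n :: complex))"
      "j < dim_col (mat_diag n (\<lambda>_. of_nat n :: complex))"
    then have ij: "i < n" "j < n" by (auto simp: mat_diag_def)
    have nz: "\<omega> i \<noteq> 0" using \<omega>_root[OF ij(1)] n by (auto simp: zero_power)
    define q where "q = inverse (\<omega> i) * \<omega> j"
    have "(?F' * fourier) $$ (i, j) = (\<Sum>l = 0..<n. q ^ l)"
      using ij by (simp add: fourier_def scalar_prod_def q_def power_mult_distrib)
    also have "\<dots> = (if i = j then of_nat n else 0)"
    proof (cases "i = j")
      case False
      then have "\<omega> i \<noteq> \<omega> j" using \<omega> ij by (auto simp: bij_betw_def inj_on_def)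
      then have "q \<noteq> 1" using nz by (auto simp: q_def field_simps)
      moreover have "q ^ n = 1" using \<omega>_root ij by (simp add: q_def power_mult_distrib power_inverse)
      ultimately show ?thesis
        using False geometric_sum[of q n] by (simp add: atLeast0LessThan)
    qed (use nz in \<open>simp add: q_def\<close>)
    finally show "(?F' * fourier) $$ (i, j) = mat_diag n (\<lambda>_. of_nat n) $$ (i, j)"
      using ij by (simp add: mat_diag_def)
  qed (auto simp: fourier_def mat_diag_def)
  then have "Determinant.det ?F' * Determinant.det fourier = of_nat n ^ n"
    using det_mult[of ?F' n fourier] by (simp add: det_mat_diag)
  then show ?thesis using n by auto
qed

text \<open>As circulant matrices commute, the block determinant equals the determinant of
  \<open>a * d - b * c\<close> formed from the blocks. The Fourier matrix turns this into a diagonal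
  matrix, and its own nonzero determinant cancels.\<close>

lemma det_circulant_blocks_aux:
  "Determinant.det (four_block_mat (circulant n a) (circulant n b) (circulant n c) (circulant n d))
     = (\<Prod>j = 0..<n. symbol n a (\<omega> j) * symbol n d (\<omega> j) - symbol n b (\<omega> j) * symbol n c (\<omega> j))"
proof -
  let ?C = "circulant n" and ?D = "\<lambda>a. mat_diag n (\<lambda>j. symbol n a (\<omega> j))"
  let ?M = "?C a * ?C d - ?C b * ?C c"
  have CC: "?C a * ?C b * fourier = fourier * (?D a * ?D b)" for a b
  proof -
    have "?C a * ?C b * fourier = ?C a * (?C b * fourier)"
      by (rule assoc_mult_mat[of _ n n _ n _ n]) simp_all
    also have "\<dots> = ?C a * fourier * ?D b"
      unfolding circulant_mult_fourier[of b] by (rule assoc_mult_mat[of _ n n _ n _ n, symmetric]) simp_all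
    also have "\<dots> = fourier * (?D a * ?D b)"
      unfolding circulant_mult_fourier[of a] by (rule assoc_mult_mat[of _ n n _ n _ n]) simp_all
    finally show ?thesis .
  qed
  have carr: "?C a * ?C b \<in> carrier_mat n n" "?D a * ?D b \<in> carrier_mat n n" for a b
    by (rule mult_carrier_mat[of _ n n]; simp)+
  have "?M * fourier = fourier * (?D a * ?D d - ?D b * ?D c)"
    using minus_mult_distrib_mat[OF carr(1) carr(1) fourier_carrier]
      mult_minus_distrib_mat[OF fourier_carrier carr(2) carr(2)] by (simp only: CC)
  moreover have "?D a * ?D d - ?D b * ?D c
      = mat_diag n (\<lambda>j. symbol n a (\<omega> j) * symbol n d (\<omega> j) - symbol n b (\<omega> j) * symbol n c (\<omega> j))"
    unfolding mat_diag_diag by (rule eq_matI) (auto simp: mat_diag_def)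
  ultimately have "Determinant.det (?M * fourier) = Determinant.det (fourier
      * mat_diag n (\<lambda>j. symbol n a (\<omega> j) * symbol n d (\<omega> j) - symbol n b (\<omega> j) * symbol n c (\<omega> j)))"
    by (simp only:)
  then have "Determinant.det ?M = (\<Prod>j = 0..<n. symbol n a (\<omega> j) * symbol n d (\<omega> j) - symbol n b (\<omega> j) * symbol n c (\<omega> j))"
    using det_fourier_nonzero
    by (simp only: det_mult[OF minus_carrier_mat[OF carr(1)] fourier_carrier]
        det_mult[OF fourier_carrier mat_diag_dim] det_mat_diag) simp
  then show ?thesis
    using det_four_block_mat[OF circulant_carrier circulant_carrier circulant_carrier circulant_carrier
        circulant_mult_commute, of n a b c d] by (simp only:)
qed

end

lemma det_circulant_blocks:
  fixes a b c d :: "int \<Rightarrow> complex"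
  assumes "n > 0"
  shows "Determinant.det (four_block_mat (circulant n a) (circulant n b) (circulant n c) (circulant n d))
     = (\<Prod>z | z ^ n = 1. symbol n a z * symbol n d z - symbol n b z * symbol n c z)"
proof -
  define \<omega> where "\<omega> = (\<lambda>k. cis (2 * pi * real k / real n))"
  have \<omega>: "bij_betw \<omega> {0..<n} {z. z ^ n = 1}"
    using Complex.bij_betw_roots_unity[OF assms] by (simp add: \<omega>_def atLeast0LessThan)
  show ?thesis
    unfolding det_circulant_blocks_aux[OF assms \<omega>] by (rule prod.reindex_bij_betw[OF \<omega>])
qed

section \<open>Bicirculant graphs\<close>

locale bicirculant_data =
  fixes n :: nat and R T S :: "int set"
  assumes n: "n > 0"
    and R: "R \<subseteq> {1..<int n}" "\<And>x. x \<in> R \<Longrightarrow> (- x) mod int n \<in> R"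
    and T: "T \<subseteq> {1..<int n}" "\<And>x. x \<in> T \<Longrightarrow> (- x) mod int n \<in> T"
    and S: "S \<subseteq> {0..<int n}"
begin

abbreviation "G \<equiv> bicirculant n R T S"
abbreviation "E \<equiv> uedges G"

lemma neg_mod_iff:
  assumes "\<And>x. x \<in> Q \<Longrightarrow> (- x) mod int n \<in> Q"
  shows "(h - g) mod int n \<in> Q \<longleftrightarrow> (g - h) mod int n \<in> Q"
  using assms[of "(h - g) mod int n"] assms[of "(g - h) mod int n"] by (auto simp: mod_simps)

text \<open>An unordered pair within one level can be read in two directions; the symmetry of
  \<open>R\<close> and \<open>T\<close> makes the readings agree. The second level is written
  \<open>Suc 0\<close>, the simp normal form of 1.\<close>

lemma edge_iff:
  "{(0, h), (0, g)} \<in> E \<longleftrightarrow> h \<in> {0..<int n} \<and> g \<in> {0..<int n} \<and> (g - h) mod int n \<in> R"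
  "{(Suc 0, h), (Suc 0, g)} \<in> E \<longleftrightarrow> h \<in> {0..<int n} \<and> g \<in> {0..<int n} \<and> (g - h) mod int n \<in> T"
  "{(0, h), (Suc 0, g)} \<in> E \<longleftrightarrow> h \<in> {0..<int n} \<and> g \<in> {0..<int n} \<and> (g - h) mod int n \<in> S"
  "{(Suc 0, g), (0, h)} \<in> E \<longleftrightarrow> h \<in> {0..<int n} \<and> g \<in> {0..<int n} \<and> (g - h) mod int n \<in> S"
  using neg_mod_iff[of R, OF R(2)] neg_mod_iff[of T, OF T(2)]
  by (auto simp: bicirculant_def doubleton_eq_iff)

lemma edge_cases:
  assumes "e \<in> E"
  obtains h g where "e = {(0, h), (0, g)}" | h g where "e = {(Suc 0, h), (Suc 0, g)}"
    | h g where "e = {(0, h), (Suc 0, g)}"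
  using assms by (auto simp: bicirculant_def)

sublocale simple_ugraph G "{0, 1} \<times> {0..<int n}" E
proof
  fix e assume "e \<in> E"
  then show "\<exists>x y. e = {x, y}" by (rule edge_cases) blast+
next
  fix x y assume e: "{x, y} \<in> E"
  obtain i h j g where xy: "x = (i, h)" "y = (j, g)" by fastforce
  have "(i = 0 \<or> i = Suc 0) \<and> (j = 0 \<or> j = Suc 0)"
    using e by (rule edge_cases) (auto simp: xy doubleton_eq_iff)
  then show "x \<in> {0, 1} \<times> {0..<int n} \<and> x \<noteq> y"
    using e R(1) T(1) edge_iff(1,2)[of g g] by (auto simp: xy edge_iff)
qed (auto simp: bicirculant_def)

lemma card_shift:
  assumes "Q \<subseteq> {0..<int n}" "h \<in> {0..<int n}"
  shows "card {g \<in> {0..<int n}. (g - h) mod int n \<in> Q} = card Q"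
    and "card {g \<in> {0..<int n}. (h - g) mod int n \<in> Q} = card Q"
proof -
  have "card {x \<in> {0..<int n}. f x \<in> Q} = card Q" if f: "bij_betw f {0..<int n} {0..<int n}" for f
  proof -
    have "f ` {x \<in> {0..<int n}. f x \<in> Q} = Q"
    proof (rule subset_antisym; rule subsetI)
      fix y assume "y \<in> Q"
      then obtain x where "x \<in> {0..<int n}" "y = f x"
        using f assms(1) unfolding bij_betw_def by blast
      then show "y \<in> f ` {x \<in> {0..<int n}. f x \<in> Q}" using \<open>y \<in> Q\<close> by blast
    qed auto
    moreover have "inj_on f {x \<in> {0..<int n}. f x \<in> Q}"
      using f by (auto simp: bij_betw_def inj_on_def)
    ultimately show ?thesis by (metis card_image)
  qed
  from this[OF bij_betw_add_mod[of "int n" "- h"]] this[OF bij_betw_diff_mod[of "int n" h]] n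
  show "card {g \<in> {0..<int n}. (g - h) mod int n \<in> Q} = card Q"
    "card {g \<in> {0..<int n}. (h - g) mod int n \<in> Q} = card Q" by simp_all
qed

lemma degree:
  assumes "h \<in> {0..<int n}"
  shows "card {w. {(0, h), w} \<in> E} = card R + card S"
    and "card {w. {(Suc 0, h), w} \<in> E} = card T + card S"
proof -
  have RT: "R \<subseteq> {0..<int n}" "T \<subseteq> {0..<int n}" using R(1) T(1) by auto
  have cl: "i = 0 \<or> i = Suc 0" if "{v, (i, g)} \<in> E" for v i g
    using that by (rule edge_cases) (auto simp: doubleton_eq_iff)
  have card: "card (Pair (0::nat) ` A \<union> Pair (Suc 0) ` B) = card A + card B"
    if "finite A" "finite B" for A B :: "int set"
    using that by (subst card_Un_disjoint) (auto simp: card_image inj_on_def)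
  have fin: "finite {g \<in> {0..<int n}. Q g}" for Q
    by (rule finite_subset[of _ "{0..<int n}"]) auto
  have nbhd: "{w. {v, w} \<in> E} = Pair 0 ` {g. {v, (0, g)} \<in> E} \<union> Pair (Suc 0) ` {g. {v, (Suc 0, g)} \<in> E}" for v
  proof (rule subset_antisym; rule subsetI)
    fix w assume w: "w \<in> {w. {v, w} \<in> E}"
    obtain i g where "w = (i, g)" by fastforce
    then show "w \<in> Pair 0 ` {g. {v, (0, g)} \<in> E} \<union> Pair (Suc 0) ` {g. {v, (Suc 0, g)} \<in> E}"
      using w cl[of v i g] by auto
  qed auto
  have sets: "{g. {(0, h), (0, g)} \<in> E} = {g \<in> {0..<int n}. (g - h) mod int n \<in> R}"
    "{g. {(0, h), (Suc 0, g)} \<in> E} = {g \<in> {0..<int n}. (g - h) mod int n \<in> S}"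
    "{g. {(Suc 0, h), (0, g)} \<in> E} = {g \<in> {0..<int n}. (h - g) mod int n \<in> S}"
    "{g. {(Suc 0, h), (Suc 0, g)} \<in> E} = {g \<in> {0..<int n}. (g - h) mod int n \<in> T}"
    using assms by (simp_all add: edge_iff)
  show "card {w. {(0, h), w} \<in> E} = card R + card S"
    using card_shift(1)[OF RT(1) assms] card_shift(1)[OF S assms]
    by (simp only: nbhd sets card[OF fin fin])
  show "card {w. {(Suc 0, h), w} \<in> E} = card T + card S"
    using card_shift(1)[OF RT(2) assms] card_shift(2)[OF S assms]
    by (simp only: nbhd sets card[OF fin fin])
qed

section \<open>The matrix \<open>I + L\<close> of a bicirculant graph in block form\<close>

definition vertex :: "nat \<Rightarrow> nat \<times> int" where
  "vertex i = (if i < n then (0, int i) else (Suc 0, int (i - n)))"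

lemma bij_betw_vertex: "bij_betw vertex {0..<n + n} ({0, 1} \<times> {0..<int n})"
  by (rule bij_betw_byWitness[where f' = "\<lambda>(b, h). b * n + nat h"])
     (auto simp: vertex_def split: if_splits)

text \<open>The first row of a diagonal block of \<open>I + L\<close>: a vertex has
  \<open>card Q\<close> neighbours in its own level and \<open>card S\<close> in the other, and the
  additional 1 comes from \<open>I\<close>.\<close>

definition loop_coeff :: "int set \<Rightarrow> int \<Rightarrow> complex" where
  "loop_coeff Q x = (if x = 0 then 1 + of_nat (card Q + card S) else if x \<in> Q then - 1 else 0)"

definition cross_coeff :: "int set \<Rightarrow> int \<Rightarrow> complex" where
  "cross_coeff Q x = (if x \<in> Q then - 1 else 0)"

lemma diff_mod_eq_0_iff: "i < n \<Longrightarrow> j < n \<Longrightarrow> (int j - int i) mod int n = 0 \<longleftrightarrow> i = j"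
  using mod_eq_dvd_iff[of "int j" "int n" "int i"] by (simp add: dvd_eq_mod_eq_0) auto

text \<open>The lower left block is the transpose of the upper right one, hence its coefficients are
  taken at \<open>- x\<close>.\<close>

lemma num_rooted_spanning_forests_bicirculant_symbol:
  "of_nat (num_rooted_spanning_forests G) = (\<Prod>z | z ^ n = 1.
     symbol n (loop_coeff R) z * symbol n (loop_coeff T) z
       - symbol n (cross_coeff S) z * symbol n (\<lambda>x. cross_coeff S ((- x) mod int n)) z)"
proof -
  let ?M = "Matrix.mat (n + n) (n + n) (\<lambda>(i, j).
      if i = j then 1 + of_nat (card {w. {vertex i, w} \<in> E}) else if {vertex i, vertex j} \<in> E then - 1 else (0::complex))"
  let ?C = "circulant n"
  have "?M = four_block_mat (?C (loop_coeff R)) (?C (cross_coeff S))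
      (?C (\<lambda>x. cross_coeff S ((- x) mod int n))) (?C (loop_coeff T))" (is "_ = ?B")
  proof (rule eq_matI)
    fix i j assume "i < dim_row ?B" "j < dim_col ?B"
    then have ij: "i < n + n" "j < n + n" by (auto simp: circulant_def)
    consider "i < n" "j < n" | "i < n" "\<not> j < n" | "\<not> i < n" "j < n" | "\<not> i < n" "\<not> j < n" by blast
    then show "?M $$ (i, j) = ?B $$ (i, j)"
    proof cases
      case 1
      then show ?thesis
        by (auto simp: circulant_def vertex_def loop_coeff_def diff_mod_eq_0_iff degree edge_iff)
    next
      case 2
      then show ?thesis
        using ij by (auto simp: circulant_def vertex_def cross_coeff_def edge_iff)
    next
      case 3
      then show ?thesis
        using ij by (auto simp: circulant_def vertex_def cross_coeff_def edge_iff mod_simps)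
    next
      case 4
      have "i = j \<longleftrightarrow> i - n = j - n" using 4 by auto
      then show ?thesis
        using ij 4 diff_mod_eq_0_iff[of "i - n" "j - n"]
        by (auto simp: circulant_def vertex_def loop_coeff_def degree edge_iff)
    qed
  qed (auto simp: circulant_def)
  then show ?thesis
    using rooted_forest_matrix_tree[OF bij_betw_vertex, where 'b=complex] by (simp add: det_circulant_blocks[OF n])
qed

lemma symbol_loop_coeff:
  assumes "Q \<subseteq> {1..<int n}"
  shows "symbol n (loop_coeff Q) z = 1 + of_nat (card Q + card S) - (\<Sum>x\<in>Q. z powi x)"
proof -
  have "symbol n (loop_coeff Q) z = loop_coeff Q 0 + (\<Sum>x\<in>{1..<int n}. loop_coeff Q x * z powi x)"
  proof -
    have "{0..<int n} = insert 0 {1..<int n}" using n by auto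
    then show ?thesis by (simp add: symbol_def)
  qed
  also have "(\<Sum>x\<in>{1..<int n}. loop_coeff Q x * z powi x) = (\<Sum>x\<in>Q. - (z powi x))"
    using assms by (intro sum.mono_neutral_cong_right) (auto simp: loop_coeff_def)
  finally show ?thesis by (simp add: loop_coeff_def[of Q 0] sum_negf)
qed

lemma symbol_cross_coeff:
  "symbol n (cross_coeff S) z = - (\<Sum>x\<in>S. z powi x)"
proof -
  have "symbol n (cross_coeff S) z = (\<Sum>x\<in>S. - (z powi x))"
    unfolding symbol_def using S by (intro sum.mono_neutral_cong_right) (auto simp: cross_coeff_def)
  then show ?thesis by (simp add: sum_negf)
qed

text \<open>Reflecting the index modulo \<open>n\<close> replaces \<open>z\<close> by its inverse,
  because \<open>z ^ n = 1\<close>.\<close>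

lemma symbol_cross_coeff_neg:
  assumes "z ^ n = 1"
  shows "symbol n (\<lambda>x. cross_coeff S ((- x) mod int n)) z = - (\<Sum>x\<in>S. inverse z powi x)"
proof -
  have "inverse z powi ((0 - x) mod int n) = z powi x" for x
    using power_int_mod_root_of_unity[OF n, of "inverse z" "- x"] assms
    by (simp add: power_inverse power_int_minus power_int_inverse)
  then have "symbol n (\<lambda>x. cross_coeff S ((- x) mod int n)) z
      = (\<Sum>x\<in>{0..<int n}. cross_coeff S ((0 - x) mod int n) * inverse z powi ((0 - x) mod int n))"
    by (simp add: symbol_def)
  also have "\<dots> = symbol n (cross_coeff S) (inverse z)"
    unfolding symbol_def by (rule sum.reindex_bij_betw[OF bij_betw_diff_mod]) (use n in auto)
  finally show ?thesis by (simp only: symbol_cross_coeff)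
qed

theorem num_rooted_spanning_forests_bicirculant:
  "of_nat (num_rooted_spanning_forests G) = (\<Prod>z | z ^ n = 1.
     (1 + of_nat (card R + card S) - (\<Sum>x\<in>R. z powi x)) * (1 + of_nat (card T + card S) - (\<Sum>x\<in>T. z powi x))
       - (\<Sum>x\<in>S. inverse z powi x) * (\<Sum>x\<in>S. z powi x) :: complex)"
  unfolding num_rooted_spanning_forests_bicirculant_symbol
  by (rule prod.cong[OF refl])
     (simp add: symbol_loop_coeff[OF R(1)] symbol_loop_coeff[OF T(1)] symbol_cross_coeff symbol_cross_coeff_neg)

end

section \<open>Laurent polynomials and Chebyshev transforms\<close>

definition leval :: "laurent \<Rightarrow> 'a::field \<Rightarrow> 'a" where
  "leval P z = (\<Sum>e\<in>Poly_Mapping.keys P. of_int (lcoeff P e) * z powi e)"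

lemma leval_superset:
  assumes "finite K" "Poly_Mapping.keys P \<subseteq> K"
  shows "leval P z = (\<Sum>e\<in>K. of_int (lcoeff P e) * z powi e)"
  unfolding leval_def using assms by (intro sum.mono_neutral_left) (auto simp: in_keys_iff)

lemma leval_zero [simp]: "leval 0 z = 0"
  by (simp add: leval_def)

lemma leval_add: "leval (P + Q) z = leval P z + leval Q z"
proof -
  let ?K = "Poly_Mapping.keys P \<union> Poly_Mapping.keys Q"
  have "leval P z = (\<Sum>e\<in>?K. of_int (lcoeff P e) * z powi e)"
    "leval Q z = (\<Sum>e\<in>?K. of_int (lcoeff Q e) * z powi e)"
    "leval (P + Q) z = (\<Sum>e\<in>?K. of_int (lcoeff (P + Q) e) * z powi e)"
    using Poly_Mapping.keys_add[of P Q] by (intro leval_superset; auto)+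
  then show ?thesis by (simp add: lookup_add algebra_simps sum.distrib)
qed

lemma leval_uminus: "leval (- P) z = - leval P z"
  using leval_add[of P "- P" z] by (simp add: eq_neg_iff_add_eq_0 add.commute)

lemma leval_diff: "leval (P - Q) z = leval P z - leval Q z"
  using leval_add[of P "- Q" z] by (simp add: leval_uminus)

lemma leval_sum: "leval (\<Sum>i\<in>I. P i) z = (\<Sum>i\<in>I. leval (P i) z)"
  by (induction I rule: infinite_finite_induct) (auto simp: leval_add)

lemma leval_single: "leval (Poly_Mapping.single e c) z = of_int c * z powi e"
  by (simp add: leval_def)

lemma laurent_sum_singles:
  "(\<Sum>e\<in>Poly_Mapping.keys P. Poly_Mapping.single e (lcoeff P e)) = (P :: laurent)"
  by (rule poly_mapping_eqI) (auto simp: lookup_sum lookup_single when_def in_keys_iff)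

text \<open>Expands the convolution product into monomials, so that multiplicativity of evaluation
  and of reflection only has to be checked on monomials.\<close>

lemma laurent_mult_sum_singles:
  fixes P Q :: laurent
  shows "P * Q = (\<Sum>d\<in>Poly_Mapping.keys P. \<Sum>e\<in>Poly_Mapping.keys Q.
           Poly_Mapping.single (d + e) (lcoeff P d * lcoeff Q e))"
proof -
  have "P * Q = (\<Sum>d\<in>Poly_Mapping.keys P. Poly_Mapping.single d (lcoeff P d))
      * (\<Sum>e\<in>Poly_Mapping.keys Q. Poly_Mapping.single e (lcoeff Q e))"
    by (simp only: laurent_sum_singles)
  then show ?thesis by (simp add: sum_product mult_single)
qed

lemma leval_mult: "z \<noteq> 0 \<Longrightarrow> leval (P * Q) z = leval P z * leval Q z"
  by (subst laurent_mult_sum_singles)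
     (simp add: leval_sum leval_single leval_def[of P] leval_def[of Q] sum_product power_int_add mult_ac)

lemma leval_one [simp]: "leval 1 z = 1"
  by (simp add: leval_single flip: single_one)

lemma leval_2 [simp]: "leval 2 z = 2"
  using leval_add[of 1 1 z] by simp

lemma leval_zpow [simp]: "leval (zpow e) z = z powi e"
  by (simp add: zpow_def leval_single)

lemma leval_lconst [simp]: "leval (lconst c) z = of_int c"
  by (simp add: lconst_def leval_single)

lemma leval_lap_poly:
  "leval (lap_poly r s \<alpha>) z = of_nat (2 * r + s + 1) - (\<Sum>j=1..r. z powi \<alpha> j + z powi (- \<alpha> j))"
  by (simp add: lap_poly_def leval_diff leval_sum leval_add)

lemma leval_cross_poly: "leval (cross_poly s \<gamma>) z = - (\<Sum>j=1..s. z powi \<gamma> j)"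
  by (simp add: cross_poly_def leval_uminus leval_sum)

section \<open>The reflection of a Laurent polynomial\<close>

lemma keys_lreflect: "Poly_Mapping.keys (lreflect P) = uminus ` Poly_Mapping.keys P"
  by (force simp: in_keys_iff lcoeff_lreflect intro!: image_eqI)

lemma leval_lreflect: "leval (lreflect P) z = leval P (inverse z)"
  by (simp add: leval_def keys_lreflect sum.reindex lcoeff_lreflect power_int_minus power_int_inverse)

lemma lreflect_lreflect [simp]: "lreflect (lreflect P) = P"
  by (rule poly_mapping_eqI) (simp add: lcoeff_lreflect)

lemma lreflect_add: "lreflect (P + Q) = lreflect P + lreflect Q"
  by (rule poly_mapping_eqI) (simp add: lcoeff_lreflect lookup_add)

lemma lreflect_zero [simp]: "lreflect 0 = 0"
  by (rule poly_mapping_eqI) (simp add: lcoeff_lreflect)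

lemma lreflect_diff: "lreflect (P - Q) = lreflect P - lreflect Q"
  by (rule poly_mapping_eqI) (simp add: lcoeff_lreflect lookup_minus)

lemma lreflect_sum: "lreflect (\<Sum>i\<in>I. P i) = (\<Sum>i\<in>I. lreflect (P i))"
  by (induction I rule: infinite_finite_induct) (auto simp: lreflect_add)

lemma lreflect_single: "lreflect (Poly_Mapping.single e c) = Poly_Mapping.single (- e) c"
  by (rule poly_mapping_eqI) (auto simp: lcoeff_lreflect lookup_single when_def)

lemma lreflect_mult: "lreflect (P * Q) = lreflect P * lreflect Q"
proof -
  have "lreflect (P * Q) = (\<Sum>d\<in>Poly_Mapping.keys P. \<Sum>e\<in>Poly_Mapping.keys Q.
           Poly_Mapping.single (- d) (lcoeff P d) * Poly_Mapping.single (- e) (lcoeff Q e))"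
    by (subst laurent_mult_sum_singles) (simp add: lreflect_sum lreflect_single mult_single)
  also have "\<dots> = lreflect (\<Sum>d\<in>Poly_Mapping.keys P. Poly_Mapping.single d (lcoeff P d))
      * lreflect (\<Sum>e\<in>Poly_Mapping.keys Q. Poly_Mapping.single e (lcoeff Q e))"
    by (simp add: lreflect_sum lreflect_single sum_product)
  finally show ?thesis by (simp add: laurent_sum_singles)
qed

lemma lreflect_one [simp]: "lreflect 1 = 1"
  by (metis lreflect_single minus_zero single_one)

lemma lreflect_2 [simp]: "lreflect 2 = 2"
  using lreflect_add[of 1 1] by simp

lemma lreflect_lap_poly [simp]: "lreflect (lap_poly r s \<alpha>) = lap_poly r s \<alpha>"
  by (simp add: lap_poly_def lconst_def zpow_def lreflect_diff lreflect_sum lreflect_add lreflect_single add.commute)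

text \<open>Reflection is an involutive ring homomorphism, so it merely swaps the factors of
  \<open>lreflect C * C\<close>.\<close>

lemma lreflect_det_poly:
  "lreflect A = A \<Longrightarrow> lreflect B = B \<Longrightarrow>
   lreflect (A * B - lreflect C * C) = A * B - lreflect C * C"
  by (simp add: lreflect_diff lreflect_mult mult.commute)

section \<open>Chebyshev polynomials and the substitution \<open>(z + 1/z) / 2\<close>\<close>

text \<open>The algebraic form of the cosine identity, with \<open>z\<close> in the role of
  \<open>exp (i * \<theta>)\<close>; it follows from the recurrence alone and so holds at every
  nonzero \<open>z\<close>.\<close>

lemma poly_cheb_joukowski:
  fixes z :: "'a::field_char_0"
  assumes "z \<noteq> 0"
  shows "poly (cheb m) ((z + inverse z) / 2) = (z ^ m + inverse z ^ m) / 2"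
proof (induction m rule: cheb.induct)
  case (3 m)
  let ?x = "(z + inverse z) / 2"
  have "poly (cheb (Suc (Suc m))) ?x = (z + inverse z) * poly (cheb (Suc m)) ?x - poly (cheb m) ?x"
    by simp
  also have "\<dots> = ((z + inverse z) * (z ^ Suc m + inverse z ^ Suc m) - (z ^ m + inverse z ^ m)) / 2"
    unfolding 3 by (simp add: diff_divide_distrib)
  also have "(z + inverse z) * (z ^ Suc m + inverse z ^ Suc m)
      = z ^ Suc (Suc m) + inverse z ^ Suc (Suc m) + (z * inverse z) * (z ^ m + inverse z ^ m)"
    by (simp add: algebra_simps)
  finally show ?case using assms by simp
qed simp_all

text \<open>Only a bound, since 2 may vanish in the coefficient ring.\<close>

lemma degree_cheb_le: "degree (cheb m :: 'a::comm_ring_1 poly) \<le> m"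
proof (induction m rule: cheb.induct)
  case (3 m)
  have "degree ([:0, 2:] * cheb (Suc m) :: 'a poly) \<le> Suc (Suc m)"
    using 3(1) degree_mult_le[of "[:0, 2 :: 'a:]" "cheb (Suc m)"] by (simp split: if_splits)
  then show ?case using 3(2) by (simp only: cheb.simps) (intro degree_diff_le, auto)
qed auto

lemma coeff_cheb_Suc: "Polynomial.coeff (cheb (Suc m) :: 'a::comm_ring_1 poly) (Suc m) = 2 ^ m"
proof (induction m rule: nat_less_induct)
  case (1 m)
  show ?case
  proof (cases m)
    case (Suc l)
    have "Polynomial.coeff (cheb l :: 'a poly) (Suc (Suc l)) = 0"
      by (rule coeff_eq_0) (use degree_cheb_le[of l, where 'a='a] in linarith)
    then show ?thesis using 1 Suc by simp
  qed simp
qed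

text \<open>Symmetry confines the exponents to the range from \<open>- k\<close> to \<open>k\<close>
  and pairs \<open>z ^ j\<close> with its inverse; each pair is twice a Chebyshev value.\<close>

lemma leval_eq_poly_cheb_transform:
  fixes z :: complex
  assumes sym: "lreflect P = P" and deg: "ldegree P = int k" and z: "z \<noteq> 0"
  shows "leval P z = poly (cheb_transform P) ((z + inverse z) / 2)"
proof -
  have sym': "lcoeff P (- e) = lcoeff P e" for e
    using sym lcoeff_lreflect[of P e] by simp
  have le: "e \<le> int k" if "e \<in> Poly_Mapping.keys P" for e
    using that deg Max_ge[of "Poly_Mapping.keys P" e] by (simp add: ldegree_def)
  have keys: "Poly_Mapping.keys P \<subseteq> insert 0 (int ` {1..k} \<union> (\<lambda>j. - int j) ` {1..k})"
  proof
    fix e assume e: "e \<in> Poly_Mapping.keys P"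
    then have "- e \<in> Poly_Mapping.keys P" by (simp add: in_keys_iff sym')
    with e have "\<bar>e\<bar> \<le> int k" using le[of e] le[of "- e"] by simp
    then have "e = 0 \<or> (nat \<bar>e\<bar> \<in> {1..k} \<and> (e = int (nat \<bar>e\<bar>) \<or> e = - int (nat \<bar>e\<bar>)))" by auto
    then show "e \<in> insert 0 (int ` {1..k} \<union> (\<lambda>j. - int j) ` {1..k})" by blast
  qed
  have "leval P z = (\<Sum>e\<in>insert 0 (int ` {1..k} \<union> (\<lambda>j. - int j) ` {1..k}). of_int (lcoeff P e) * z powi e)"
    by (rule leval_superset[OF _ keys]) auto
  also have "\<dots> = of_int (lcoeff P 0) + ((\<Sum>e\<in>int ` {1..k}. of_int (lcoeff P e) * z powi e)
      + (\<Sum>e\<in>(\<lambda>j. - int j) ` {1..k}. of_int (lcoeff P e) * z powi e))"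
    by (subst sum.insert, simp, force, subst sum.union_disjoint) auto
  also have "\<dots> = of_int (lcoeff P 0) + (\<Sum>j=1..k. of_int (lcoeff P (int j)) * (z ^ j + inverse z ^ j))"
    by (simp add: sum.reindex inj_on_def sym' power_int_minus power_inverse flip: sum.distrib)
       (simp add: distrib_left)
  also have "\<dots> = poly (cheb_transform P) ((z + inverse z) / 2)"
    by (simp add: cheb_transform_def deg poly_sum poly_cheb_joukowski[OF z])
  finally show ?thesis .
qed

text \<open>The Chebyshev transform is split into linear factors. Its leading coefficient carries
  \<open>2 ^ k\<close>, and one factor 2 goes into each linear factor.\<close>

lemma leval_eq_prod_roots:
  assumes sym: "lreflect P = P" and deg: "ldegree P = int k" and z: "z \<noteq> 0"
    and roots: "lists_roots k w (cheb_transform P)"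
  shows "leval P z = of_int (lcoeff P (int k)) * (\<Prod>l=1..k. z + inverse z - 2 * w l)"
proof -
  let ?U = "cheb_transform P"
  have proots: "proots ?U = image_mset w (mset_set {1..k})"
    using roots by (simp add: lists_roots_def)
  \<comment> \<open>A complex polynomial has as many roots, with multiplicity, as its degree, so the
    list of \<open>k\<close> roots determines the degree.\<close>
  have "degree ?U = k"
    using size_proots_complex[of ?U] proots by simp
  \<comment> \<open>For \<open>k > 0\<close> the factor 2 of the transform meets the leading
    coefficient \<open>2 ^ (k - 1)\<close> of \<open>cheb k\<close>; for \<open>k = 0\<close> the
    constant term carries no factor 2.\<close>
  moreover have "Polynomial.coeff ?U k = 2 ^ k * of_int (lcoeff P (int k))"
  proof (cases k)
    case (Suc m)
    have "Polynomial.coeff ?U k = (\<Sum>j=1..k. 2 * of_int (lcoeff P (int j)) * Polynomial.coeff (cheb j) k)"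
      using Suc by (simp only: cheb_transform_def deg nat_int coeff_add coeff_sum coeff_smult) simp
    also have "\<dots> = (\<Sum>j\<in>{k}. 2 * of_int (lcoeff P (int j)) * Polynomial.coeff (cheb j) k)"
    proof (rule sum.mono_neutral_right)
      have "Polynomial.coeff (cheb j :: complex poly) k = 0" if "j < k" for j
        by (rule coeff_eq_0) (use degree_cheb_le[of j, where 'a=complex] that in linarith)
      then show "\<forall>j\<in>{1..k} - {k}. 2 * of_int (lcoeff P (int j)) * Polynomial.coeff (cheb j :: complex poly) k = 0" by auto
    qed (use Suc in auto)
    finally show ?thesis using Suc by (simp add: coeff_cheb_Suc)
  qed (simp add: cheb_transform_def deg)
  ultimately have U: "?U = Polynomial.smult (2 ^ k * of_int (lcoeff P (int k))) (\<Prod>l=1..k. [:- w l, 1:])"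
    using complex_poly_decompose_multiset[of ?U] by (simp add: proots image_mset.compositionality comp_def prod_unfold_prod_mset)
  have "leval P z = poly ?U ((z + inverse z) / 2)"
    by (rule leval_eq_poly_cheb_transform[OF sym deg z])
  also have "\<dots> = of_int (lcoeff P (int k)) * (2 ^ card {1..k} * (\<Prod>l=1..k. (z + inverse z) / 2 - w l))"
    by (subst U) (simp add: poly_prod)
  also have "2 ^ card {1..k} * (\<Prod>l=1..k. (z + inverse z) / 2 - w l) = (\<Prod>l=1..k. 2 * ((z + inverse z) / 2 - w l))"
    by (simp only: prod.distrib prod_constant)
  also have "\<dots> = (\<Prod>l=1..k. z + inverse z - 2 * w l)"
    by (intro prod.cong) (auto simp: field_simps)
  finally show ?thesis .
qed

section \<open>Products over the solutions of \<open>z ^ m = c\<close>\<close>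

text \<open>The derivative of \<open>z ^ m - c\<close> has no zero other than 0, and 0 is not a root
  as \<open>c\<close> is nonzero. So all roots are simple and the product over the set of roots is
  the polynomial itself.\<close>

lemma prod_diff_roots:
  fixes c x :: complex
  assumes "m > 0" "c \<noteq> 0"
  shows "(\<Prod>z | z ^ m = c. x - z) = x ^ m - c"
proof -
  let ?p = "Polynomial.monom 1 m - [:c:] :: complex poly"
  have ev: "poly ?p z = z ^ m - c" for z by (simp add: poly_monom)
  have lead: "Polynomial.coeff ?p m = 1" and "degree ?p \<le> m"
    using assms by (auto intro!: degree_diff_le simp: degree_monom_le coeff_pCons split: nat.split)
  then have deg: "degree ?p = m" by (simp add: le_antisym le_degree)
  have "rsquarefree ?p"
    unfolding rsquarefree_roots
  proof (intro allI notI, elim conjE)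
    fix z assume "poly ?p z = 0" "poly (pderiv ?p) z = 0"
    then show False using assms by (auto simp: ev pderiv_diff pderiv_monom poly_monom pderiv_pCons zero_power)
  qed
  then have "Polynomial.smult (lead_coeff ?p) (\<Prod>z | poly ?p z = 0. [:- z, 1:]) = ?p"
    by (rule complex_poly_decompose_rsquarefree)
  then have "poly (\<Prod>z | z ^ m = c. [:- z, 1:]) x = poly ?p x"
    by (simp only: deg lead ev) (simp add: poly_monom)
  then show ?thesis by (simp only: poly_prod ev) simp
qed

text \<open>The witness \<open>w + q\<close> solves
  \<open>\<zeta>\<^sup>2 - 2 * w * \<zeta> + 1 = 0\<close>; the other solution \<open>w - q\<close>
  is its inverse.\<close>

lemma joukowski_surj:
  fixes w :: complex
  obtains \<zeta> where "\<zeta> \<noteq> 0" "w = (\<zeta> + inverse \<zeta>) / 2"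
proof -
  define q where "q = csqrt (w\<^sup>2 - 1)"
  have q: "(w + q) * (w - q) = 1"
    by (simp add: q_def algebra_simps flip: power2_eq_square)
  then have "w + q \<noteq> 0" "inverse (w + q) = w - q" using inverse_unique[OF q] by auto
  then show ?thesis by (intro that[of "w + q"]) auto
qed

text \<open>With \<open>2 * w = \<zeta> + inverse \<zeta>\<close>, multiplying a factor by
  \<open>z\<close> turns it into \<open>(\<zeta> - z) * (inverse \<zeta> - z)\<close>. As
  \<open>cmod z = 1\<close>, the norm is unchanged, and the two resulting products are given by
  \<open>prod_diff_roots\<close>.\<close>

lemma norm_prod_roots_cheb:
  fixes c w :: complex
  assumes m: "m > 0" and c: "c = 1 \<or> c = - 1"
  shows "cmod (\<Prod>z | z ^ m = c. z + inverse z - 2 * w) = cmod (2 * poly (cheb m) w - 2 * c)"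
proof -
  obtain \<zeta> where \<zeta>: "\<zeta> \<noteq> 0" "w = (\<zeta> + inverse \<zeta>) / 2" by (rule joukowski_surj)
  have nz: "cmod z = 1 \<and> z \<noteq> 0" if "z ^ m = c" for z
  proof -
    have "cmod z ^ m = 1" using that c by (auto simp flip: norm_power)
    then have "cmod z = 1" using m power_eq_imp_eq_base[of "cmod z" m 1] by simp
    then show ?thesis by auto
  qed
  have "cmod (z + inverse z - 2 * w) = cmod (\<zeta> - z) * cmod (inverse \<zeta> - z)" if "z ^ m = c" for z
  proof -
    have "z * (z + inverse z - 2 * w) = (\<zeta> - z) * (inverse \<zeta> - z)"
    proof -
      have "2 * w = \<zeta> + inverse \<zeta>" using \<zeta>(2) by (simp add: mult.commute)
      then show ?thesis using \<zeta>(1) nz[OF that] by (simp only:) (simp add: field_simps)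
    qed
    then have "cmod z * cmod (z + inverse z - 2 * w) = cmod (\<zeta> - z) * cmod (inverse \<zeta> - z)"
      by (metis norm_mult)
    then show ?thesis using nz[OF that] by simp
  qed
  then have "cmod (\<Prod>z | z ^ m = c. z + inverse z - 2 * w)
      = cmod (\<Prod>z | z ^ m = c. \<zeta> - z) * cmod (\<Prod>z | z ^ m = c. inverse \<zeta> - z)"
    by (simp add: prod_norm[symmetric] prod.distrib[symmetric])
  also have "\<dots> = cmod ((\<zeta> ^ m - c) * (inverse \<zeta> ^ m - c))"
    using m c by (subst (1 2) prod_diff_roots) (auto simp: norm_mult)
  \<comment> \<open>Since \<open>c * c = 1\<close>, both sides expand to
    \<open>2 - 2 * c * poly (cheb m) w\<close>.\<close>
  also have "(\<zeta> ^ m - c) * (inverse \<zeta> ^ m - c) = - c * (2 * poly (cheb m) w - 2 * c)"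
  proof -
    have "\<zeta> ^ m * inverse \<zeta> ^ m = 1" using \<zeta>(1) by (simp flip: power_mult_distrib)
    moreover have "c * c = 1" using c by auto
    moreover have "2 * poly (cheb m) w = \<zeta> ^ m + inverse \<zeta> ^ m"
      using poly_cheb_joukowski[OF \<zeta>(1), of m] by (simp add: \<zeta>(2) mult.commute[of 2])
    ultimately show ?thesis by (simp only: algebra_simps) simp
  qed
  also have "cmod \<dots> = cmod (2 * poly (cheb m) w - 2 * c)"
    using c by (auto simp: norm_mult)
  finally show ?thesis .
qed

text \<open>After factoring \<open>P\<close> the two products are swapped; the leading coefficient
  occurs once for each of the \<open>m\<close> solutions.\<close>

lemma norm_prod_leval:
  assumes sym: "lreflect P = P" and deg: "ldegree P = int k"
    and roots: "lists_roots k w (cheb_transform P)"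
    and m: "m > 0" and c: "c = 1 \<or> c = - 1"
  shows "cmod (\<Prod>z | z ^ m = c. leval P z)
    = \<bar>real_of_int (lcoeff P (int k))\<bar> ^ m * (\<Prod>l=1..k. cmod (2 * poly (cheb m) (w l) - 2 * c))"
proof -
  have "c \<noteq> 0" using c by auto
  then have nz: "z \<noteq> 0" if "z ^ m = c" for z using that m by (auto simp: zero_power)
  have "(\<Prod>z | z ^ m = c. leval P z)
      = (\<Prod>z | z ^ m = c. of_int (lcoeff P (int k)) * (\<Prod>l=1..k. z + inverse z - 2 * w l))"
    by (rule prod.cong[OF refl]) (simp add: leval_eq_prod_roots[OF sym deg nz roots])
  also have "\<dots> = of_int (lcoeff P (int k)) ^ m * (\<Prod>l=1..k. \<Prod>z | z ^ m = c. z + inverse z - 2 * w l)"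
    using card_nth_roots[OF \<open>c \<noteq> 0\<close> m] by (subst prod.swap) (simp add: prod.distrib)
  finally show ?thesis
    by (simp add: norm_mult norm_power norm_prod_roots_cheb[OF m c] prod_norm[of _ "{1..k}", symmetric]
        del: One_nat_def)
qed

section \<open>The forest formula\<close>

locale bicirculant_parameters =
  fixes n r t s :: nat and \<alpha> \<beta> \<gamma> :: "nat \<Rightarrow> int"
  assumes n: "n \<ge> 1"
    and \<alpha>: "strict_mono_on {1..r} \<alpha>" "\<And>j. j \<in> {1..r} \<Longrightarrow> 1 \<le> \<alpha> j \<and> 2 * \<alpha> j < int n"
    and \<beta>: "strict_mono_on {1..t} \<beta>" "\<And>j. j \<in> {1..t} \<Longrightarrow> 1 \<le> \<beta> j \<and> 2 * \<beta> j < int n"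
    and \<gamma>: "strict_mono_on {1..s} \<gamma>" "\<And>j. j \<in> {1..s} \<Longrightarrow> 0 \<le> \<gamma> j \<and> \<gamma> j \<le> int n - 1"

text \<open>As \<open>2 * \<alpha> j < int n\<close>, the residues \<open>\<alpha> j\<close> lie
  strictly between 0 and \<open>n / 2\<close>, and the residues \<open>n - \<alpha> j\<close>
  strictly between \<open>n / 2\<close> and \<open>n\<close>. So no two coincide and none is 0 or
  \<open>n / 2\<close>.\<close>

lemma pm_residues_props:
  assumes n: "n \<ge> 1" and \<alpha>: "strict_mono_on {1..r} \<alpha>" "\<And>j. j \<in> {1..r} \<Longrightarrow> 1 \<le> \<alpha> j \<and> 2 * \<alpha> j < int n"
  shows pm_residues_subset: "pm_residues n r \<alpha> \<subseteq> {1..<int n}"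
    and pm_residues_uminus: "\<And>x. x \<in> pm_residues n r \<alpha> \<Longrightarrow> (- x) mod int n \<in> pm_residues n r \<alpha>"
    and half_notin_pm_residues: "even n \<Longrightarrow> int n div 2 \<notin> pm_residues n r \<alpha>"
    and card_pm_residues: "card (pm_residues n r \<alpha>) = 2 * r"
    and sum_pm_residues: "\<And>z::'a::field. z ^ n = 1 \<Longrightarrow>
      (\<Sum>x\<in>pm_residues n r \<alpha>. z powi x) = (\<Sum>j=1..r. z powi \<alpha> j + z powi (- \<alpha> j))"
proof -
  have mods: "\<alpha> j mod int n = \<alpha> j" "(- \<alpha> j) mod int n = int n - \<alpha> j" if "j \<in> {1..r}" for j
  proof -
    show "\<alpha> j mod int n = \<alpha> j"
      using \<alpha>(2)[OF that] by (intro mod_pos_pos_trivial) auto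
    have "(int n + - \<alpha> j) mod int n = int n + - \<alpha> j"
      using \<alpha>(2)[OF that] by (intro mod_pos_pos_trivial) auto
    then show "(- \<alpha> j) mod int n = int n - \<alpha> j" by simp
  qed
  have eq: "pm_residues n r \<alpha> = \<alpha> ` {1..r} \<union> (\<lambda>j. int n - \<alpha> j) ` {1..r}"
  proof -
    have "pm_residues n r \<alpha> = (\<Union>j\<in>{1..r}. {\<alpha> j, int n - \<alpha> j})"
      unfolding pm_residues_def using mods by (intro SUP_cong) simp_all
    then show ?thesis by blast
  qed
  have pair: "\<alpha> i + \<alpha> j < int n \<and> 1 \<le> \<alpha> i \<and> 1 \<le> \<alpha> j" if "i \<in> {1..r}" "j \<in> {1..r}" for i j
    using \<alpha>(2)[OF that(1)] \<alpha>(2)[OF that(2)] by simp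
  have disj: "\<alpha> ` {1..r} \<inter> (\<lambda>j. int n - \<alpha> j) ` {1..r} = {}"
  proof -
    have "\<alpha> i \<noteq> int n - \<alpha> j" if "i \<in> {1..r}" "j \<in> {1..r}" for i j using pair[OF that] by simp
    then show ?thesis by blast
  qed
  have inj: "inj_on \<alpha> {1..r}" "inj_on (\<lambda>j. int n - \<alpha> j) {1..r}"
  proof -
    show "inj_on \<alpha> {1..r}" by (rule strict_mono_on_imp_inj_on[OF \<alpha>(1)])
    then show "inj_on (\<lambda>j. int n - \<alpha> j) {1..r}"
      by (intro inj_onI) (erule inj_onD, simp_all)
  qed
  show "pm_residues n r \<alpha> \<subseteq> {1..<int n}"
  proof -
    have "\<alpha> j \<in> {1..<int n} \<and> int n - \<alpha> j \<in> {1..<int n}" if "j \<in> {1..r}" for j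
      using pair[OF that that] by simp
    then show ?thesis unfolding eq by blast
  qed
  show "int n div 2 \<notin> pm_residues n r \<alpha>" if "even n"
  proof -
    have "int n div 2 \<noteq> \<alpha> j \<and> int n div 2 \<noteq> int n - \<alpha> j" if "j \<in> {1..r}" for j
    proof -
      obtain h where "n = 2 * h" using \<open>even n\<close> by blast
      then have "int n = 2 * int h" "int n div 2 = int h" by simp_all
      then show ?thesis using \<alpha>(2)[OF that] by linarith
    qed
    then show ?thesis unfolding eq by blast
  qed
  show "(- x) mod int n \<in> pm_residues n r \<alpha>" if x: "x \<in> pm_residues n r \<alpha>" for x
  proof -
    obtain j where "j \<in> {1..r}" "x = \<alpha> j mod int n \<or> x = (- \<alpha> j) mod int n"
      using x unfolding pm_residues_def by blast
    moreover from this(2) have "(- x) mod int n \<in> {\<alpha> j mod int n, (- \<alpha> j) mod int n}"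
      by (elim disjE) (simp_all add: mod_simps)
    ultimately show ?thesis unfolding pm_residues_def by blast
  qed
  show "card (pm_residues n r \<alpha>) = 2 * r"
    unfolding eq using disj by (subst card_Un_disjoint) (simp_all add: card_image[OF inj(1)] card_image[OF inj(2)] del: One_nat_def)
  show "(\<Sum>x\<in>pm_residues n r \<alpha>. z powi x) = (\<Sum>j=1..r. z powi \<alpha> j + z powi (- \<alpha> j))"
    if z: "z ^ n = 1" for z :: 'a
  proof -
    have "z powi (int n - \<alpha> j) = z powi (- \<alpha> j)" if "j \<in> {1..r}" for j
      using power_int_mod_root_of_unity[OF _ z, of "- \<alpha> j"] mods(2)[OF that] n by simp
    then have "(\<Sum>j=1..r. z powi (int n - \<alpha> j)) = (\<Sum>j=1..r. z powi (- \<alpha> j))"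
      by (rule sum.cong[OF refl])
    moreover have "(\<Sum>x\<in>pm_residues n r \<alpha>. z powi x)
        = (\<Sum>x\<in>\<alpha> ` {1..r}. z powi x) + (\<Sum>x\<in>(\<lambda>j. int n - \<alpha> j) ` {1..r}. z powi x)"
      unfolding eq by (rule sum.union_disjoint) (use disj in simp_all)
    ultimately show ?thesis
      by (simp only: sum.reindex[OF inj(1)] sum.reindex[OF inj(2)] o_def sum.distrib)
  qed
qed

lemma residues_of_eq_image:
  assumes "\<And>j. j \<in> {1..s} \<Longrightarrow> 0 \<le> \<gamma> j \<and> \<gamma> j \<le> int n - 1"
  shows "residues_of n s \<gamma> = \<gamma> ` {1..s}"
  unfolding residues_of_def using assms by (intro image_cong) auto

section \<open>The four graphs, indexed by two flags\<close>

context bicirculant_parameters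
begin

definition "poly_A = lap_poly r s \<alpha>"
definition "poly_B = lap_poly t s \<beta>"
definition "poly_C = cross_poly s \<gamma>"

text \<open>The flags \<open>p\<close> and \<open>q\<close> tell whether \<open>n / 2\<close> is
  added to \<open>R\<close> and to \<open>T\<close>, so that one argument serves several
  graphs.\<close>

definition conn_R where "conn_R p = pm_residues n r \<alpha> \<union> (if p then {int n div 2} else {})"
definition conn_T where "conn_T q = pm_residues n t \<beta> \<union> (if q then {int n div 2} else {})"

abbreviation "S \<equiv> residues_of n s \<gamma>"
definition "poly_P p q = (poly_A + (if p then 2 else 0)) * (poly_B + (if q then 2 else 0)) - lreflect poly_C * poly_C"

text \<open>The connection \<open>n div 2\<close> raises the degree by 1 and subtracts the power
  \<open>z ^ (n div 2)\<close>, whence the correction term.\<close>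

lemma loop_factor:
  fixes z :: "'a::field"
  assumes \<delta>: "strict_mono_on {1..m} \<delta>" "\<And>j. j \<in> {1..m} \<Longrightarrow> 1 \<le> \<delta> j \<and> 2 * \<delta> j < int n"
    and p: "p \<longrightarrow> even n" and z: "z ^ n = 1"
    and Q: "Q = pm_residues n m \<delta> \<union> (if p then {int n div 2} else {})"
  shows "1 + of_nat (card Q + card S) - (\<Sum>x\<in>Q. z powi x)
    = leval (lap_poly m s \<delta>) z + (if p then 1 - z ^ (n div 2) else 0)"
proof -
  note pm = pm_residues_props[OF n \<delta>]
  have fin: "finite (pm_residues n m \<delta>)" using pm(1) finite_subset by blast
  have S: "card S = s"
    using residues_of_eq_image[of s \<gamma> n] \<gamma> strict_mono_on_imp_inj_on[OF \<gamma>(1)] by (simp add: card_image)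
  have "z powi (int n div 2) = z ^ (n div 2)"
    by (metis of_nat_numeral power_int_of_nat zdiv_int)
  then show ?thesis
    using pm(3-5) p z fin S by (auto simp: Q leval_lap_poly)
qed

lemma sum_S: "(\<Sum>x\<in>S. z powi x) = - leval poly_C z"
  using residues_of_eq_image[of s \<gamma> n] \<gamma> strict_mono_on_imp_inj_on[OF \<gamma>(1)]
  by (simp add: poly_C_def leval_cross_poly sum.reindex)

lemma bicirculant_data:
  assumes "p \<or> q \<longrightarrow> even n"
  shows "bicirculant_data n (conn_R p) (conn_T q) S"
proof
  \<comment> \<open>For even \<open>n\<close> the residue \<open>n / 2\<close> is its own negative,
    so adding it keeps a connection set symmetric.\<close>
  have half: "int n div 2 \<in> {1..<int n} \<and> (- (int n div 2)) mod int n = int n div 2" if "even n"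
  proof -
    obtain h where h: "n = 2 * h" using \<open>even n\<close> by blast
    with n show ?thesis by (auto simp: zmod_zminus1_eq_if)
  qed
  show "conn_R p \<subseteq> {1..<int n}" "conn_T q \<subseteq> {1..<int n}"
    using pm_residues_subset[OF n \<alpha>] pm_residues_subset[OF n \<beta>] half assms
    by (auto simp: conn_R_def conn_T_def split: if_splits)
  show "(- x) mod int n \<in> conn_R p" if "x \<in> conn_R p" for x
    using that pm_residues_uminus[OF n \<alpha>] half assms by (auto simp: conn_R_def split: if_splits)
  show "(- x) mod int n \<in> conn_T q" if "x \<in> conn_T q" for x
    using that pm_residues_uminus[OF n \<beta>] half assms by (auto simp: conn_T_def split: if_splits)
  show "S \<subseteq> {0..<int n}"
    using residues_of_eq_image[of s \<gamma> n] \<gamma>(2) by fastforce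
  show "n > 0" using n by simp
qed

lemma num_forests_eq_prod:
  assumes "p \<or> q \<longrightarrow> even n"
  shows "of_nat (num_rooted_spanning_forests (bicirculant n (conn_R p) (conn_T q) S)) = (\<Prod>z | z ^ n = 1.
     (leval poly_A z + (if p then 1 - z ^ (n div 2) else 0)) * (leval poly_B z + (if q then 1 - z ^ (n div 2) else 0))
       - leval poly_C (inverse z) * leval poly_C z :: complex)"
  unfolding bicirculant_data.num_rooted_spanning_forests_bicirculant[OF bicirculant_data[OF assms]]
proof (rule prod.cong[OF refl])
  have pq: "p \<longrightarrow> even n" "q \<longrightarrow> even n" using assms by auto
  fix z :: complex assume "z \<in> {z. z ^ n = 1}"
  then have z: "z ^ n = 1" by simp
  show "(1 + of_nat (card (conn_R p) + card S) - (\<Sum>x\<in>conn_R p. z powi x))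
        * (1 + of_nat (card (conn_T q) + card S) - (\<Sum>x\<in>conn_T q. z powi x))
      - (\<Sum>x\<in>S. inverse z powi x) * (\<Sum>x\<in>S. z powi x)
    = (leval poly_A z + (if p then 1 - z ^ (n div 2) else 0)) * (leval poly_B z + (if q then 1 - z ^ (n div 2) else 0))
      - leval poly_C (inverse z) * leval poly_C z"
    using loop_factor[OF \<alpha> pq(1) z conn_R_def] loop_factor[OF \<beta> pq(2) z conn_T_def]
    by (simp only: sum_S poly_A_def poly_B_def minus_mult_minus)
qed

lemma lreflect_P: "lreflect (poly_P p q) = poly_P p q"
  unfolding poly_P_def by (rule lreflect_det_poly) (auto simp: poly_A_def poly_B_def lreflect_add)

lemma leval_P:
  "z \<noteq> 0 \<Longrightarrow> leval (poly_P p q) z = (leval poly_A z + (if p then 2 else 0)) * (leval poly_B z + (if q then 2 else 0))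
     - leval poly_C (inverse z) * leval poly_C z"
  by (simp add: poly_P_def leval_diff leval_mult leval_add leval_lreflect)

text \<open>The product over the roots of unity is a natural number and therefore equals its norm,
  so no signs have to be tracked.\<close>

lemma num_forests:
  assumes P: "ldegree (poly_P False False) = int k" "lists_roots k w (cheb_transform (poly_P False False))"
  shows "real (num_rooted_spanning_forests (bicirculant n (conn_R False) (conn_T False) S))
    = \<bar>real_of_int (lcoeff (poly_P False False) (int k))\<bar> ^ n * (\<Prod>l=1..k. cmod (2 * poly (cheb n) (w l) - 2))"
proof -
  have "of_nat (num_rooted_spanning_forests (bicirculant n (conn_R False) (conn_T False) S))
      = (\<Prod>z | z ^ n = 1. leval (poly_P False False) z :: complex)"
    unfolding num_forests_eq_prod[of False False, simplified]
    by (rule prod.cong[OF refl], subst leval_P) (use n in \<open>auto simp: zero_power\<close>)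
  then have "real (num_rooted_spanning_forests (bicirculant n (conn_R False) (conn_T False) S))
      = cmod (\<Prod>z | z ^ n = 1. leval (poly_P False False) z)"
    by (metis norm_of_nat)
  then show ?thesis
    using norm_prod_leval[OF lreflect_P P, of n 1] n by simp
qed

lemma num_forests_half:
  assumes "even n"
    and P1: "ldegree (poly_P False False) = int k" "lists_roots k w (cheb_transform (poly_P False False))"
    and P2: "ldegree (poly_P p q) = int k" "lists_roots k v (cheb_transform (poly_P p q))"
  shows "real (num_rooted_spanning_forests (bicirculant n (conn_R p) (conn_T q) S))
    = \<bar>real_of_int (lcoeff (poly_P p q) (int k))\<bar> ^ (n div 2) * \<bar>real_of_int (lcoeff (poly_P False False) (int k))\<bar> ^ (n div 2)
       * (\<Prod>l=1..k. cmod (2 * poly (cheb (n div 2)) (v l) + 2))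
       * (\<Prod>l=1..k. cmod (2 * poly (cheb (n div 2)) (w l) - 2))"
proof -
  obtain h where h: "n = 2 * h" "h > 0" using \<open>even n\<close> n by (auto elim!: evenE)
  have half: "n div 2 = h" using h by simp
  let ?N = "num_rooted_spanning_forests (bicirculant n (conn_R p) (conn_T q) S)"
  define F where "F = (\<lambda>z::complex. (leval poly_A z + (if p then 1 - z ^ h else 0)) * (leval poly_B z + (if q then 1 - z ^ h else 0))
       - leval poly_C (inverse z) * leval poly_C z)"
  \<comment> \<open>The number \<open>z ^ h\<close> is a square root of
    \<open>z ^ n = 1\<close>.\<close>
  have split: "{z::complex. z ^ n = 1} = {z. z ^ h = 1} \<union> {z. z ^ h = - 1}"
    using h by (auto simp: power_mult mult.commute[of 2] power2_eq_1_iff)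
  have "of_nat ?N = (\<Prod>z | z ^ n = 1. F z)"
    using num_forests_eq_prod[of p q] \<open>even n\<close> by (simp only: F_def half) simp
  also have "\<dots> = (\<Prod>z | z ^ h = 1. F z) * (\<Prod>z | z ^ h = - 1. F z)"
    unfolding split using h(2) by (intro prod.union_disjoint) (auto intro: finite_nth_roots)
  \<comment> \<open>Here \<open>1 - z ^ h = 0\<close>, so both corrections vanish.\<close>
  also have "(\<Prod>z | z ^ h = 1. F z) = (\<Prod>z | z ^ h = 1. leval (poly_P False False) z)"
    by (rule prod.cong[OF refl], subst leval_P) (use h(2) in \<open>auto simp: zero_power F_def\<close>)
  \<comment> \<open>Here \<open>1 - z ^ h = 2\<close>, the constant that a set flag adds in
    \<open>poly_P\<close>.\<close>
  also have "(\<Prod>z | z ^ h = - 1. F z) = (\<Prod>z | z ^ h = - 1. leval (poly_P p q) z)"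
    by (rule prod.cong[OF refl], subst leval_P) (use h(2) in \<open>auto simp: zero_power F_def\<close>)
  finally have "real ?N = cmod (\<Prod>z | z ^ h = 1. leval (poly_P False False) z) * cmod (\<Prod>z | z ^ h = - 1. leval (poly_P p q) z)"
    by (metis norm_mult norm_of_nat)
  then show ?thesis
    using norm_prod_leval[OF lreflect_P P1 h(2), of 1] norm_prod_leval[OF lreflect_P P2 h(2), of "- 1"]
    by (simp add: half mult_ac)
qed

end
theorem theorem3p1:
  fixes n r t s k :: nat
    and \<alpha> \<beta> \<gamma> :: "nat \<Rightarrow> int"
    and R T S :: "int set"
    and \<Gamma>1 \<Gamma>2 \<Gamma>3 \<Gamma>4 :: "(nat \<times> int) ugraph"
    and A B C P1 P2 P3 P4 :: laurent
    and a b c d :: int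
    and w v u y :: "nat \<Rightarrow> complex"
  assumes n: "n \<ge> 1"
    and \<alpha>: "strict_mono_on {1..r} \<alpha>" "\<And>j. j \<in> {1..r} \<Longrightarrow> 1 \<le> \<alpha> j \<and> 2 * \<alpha> j < int n"
    and \<beta>: "strict_mono_on {1..t} \<beta>" "\<And>j. j \<in> {1..t} \<Longrightarrow> 1 \<le> \<beta> j \<and> 2 * \<beta> j < int n"
    and \<gamma>: "strict_mono_on {1..s} \<gamma>" "\<And>j. j \<in> {1..s} \<Longrightarrow> 0 \<le> \<gamma> j \<and> \<gamma> j \<le> int n - 1"
    and RTS: "R = pm_residues n r \<alpha>" "T = pm_residues n t \<beta>" "S = residues_of n s \<gamma>"
    and \<Gamma>1: "\<Gamma>1 = bicirculant n R T S"
    and \<Gamma>2: "\<Gamma>2 = bicirculant n (R \<union> {int n div 2}) T S"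
    and \<Gamma>3: "\<Gamma>3 = bicirculant n R (T \<union> {int n div 2}) S"
    and \<Gamma>4: "\<Gamma>4 = bicirculant n (R \<union> {int n div 2}) (T \<union> {int n div 2}) S"
    and ABC: "A = lap_poly r s \<alpha>" "B = lap_poly t s \<beta>" "C = cross_poly s \<gamma>"
    and P1: "P1 = A * B - lreflect C * C"
    and P2: "P2 = (A + 2) * B - lreflect C * C"
    and P3: "P3 = A * (B + 2) - lreflect C * C"
    and P4: "P4 = (A + 2) * (B + 2) - lreflect C * C"
    and degrees: "ldegree P1 = int k" "ldegree P2 = int k"
                 "ldegree P3 = int k" "ldegree P4 = int k"
    and leading: "a = lcoeff P1 (int k)" "b = lcoeff P2 (int k)"
                 "c = lcoeff P3 (int k)" "d = lcoeff P4 (int k)"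
    and roots: "lists_roots k w (cheb_transform P1)" "lists_roots k v (cheb_transform P2)"
               "lists_roots k u (cheb_transform P3)" "lists_roots k y (cheb_transform P4)"
  shows "(uconnected \<Gamma>1 \<longrightarrow>
           real (num_rooted_spanning_forests \<Gamma>1)
             = \<bar>real_of_int a\<bar> ^ n * (\<Prod>l=1..k. cmod (2 * poly (cheb n) (w l) - 2)))
      \<and> (even n \<and> uconnected \<Gamma>2 \<longrightarrow>
           real (num_rooted_spanning_forests \<Gamma>2)
             = \<bar>real_of_int b\<bar> ^ (n div 2) * \<bar>real_of_int a\<bar> ^ (n div 2)
               * (\<Prod>l=1..k. cmod (2 * poly (cheb (n div 2)) (v l) + 2))
               * (\<Prod>l=1..k. cmod (2 * poly (cheb (n div 2)) (w l) - 2)))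
      \<and> (even n \<and> uconnected \<Gamma>3 \<longrightarrow>
           real (num_rooted_spanning_forests \<Gamma>3)
             = \<bar>real_of_int c\<bar> ^ (n div 2) * \<bar>real_of_int a\<bar> ^ (n div 2)
               * (\<Prod>l=1..k. cmod (2 * poly (cheb (n div 2)) (u l) + 2))
               * (\<Prod>l=1..k. cmod (2 * poly (cheb (n div 2)) (w l) - 2)))
      \<and> (even n \<and> uconnected \<Gamma>4 \<longrightarrow>
           real (num_rooted_spanning_forests \<Gamma>4)
             = \<bar>real_of_int d\<bar> ^ (n div 2) * \<bar>real_of_int a\<bar> ^ (n div 2)
               * (\<Prod>l=1..k. cmod (2 * poly (cheb (n div 2)) (y l) + 2))
               * (\<Prod>l=1..k. cmod (2 * poly (cheb (n div 2)) (w l) - 2)))"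
proof -
  interpret bicirculant_parameters n r t s \<alpha> \<beta> \<gamma>
    using n \<alpha> \<beta> \<gamma> by unfold_locales
  have polys: "P1 = poly_P False False" "P2 = poly_P True False" "P3 = poly_P False True" "P4 = poly_P True True"
    by (simp_all add: P1 P2 P3 P4 ABC poly_P_def poly_A_def poly_B_def poly_C_def)
  have graphs: "\<Gamma>1 = bicirculant n (conn_R False) (conn_T False) (residues_of n s \<gamma>)"
    "\<Gamma>2 = bicirculant n (conn_R True) (conn_T False) (residues_of n s \<gamma>)"
    "\<Gamma>3 = bicirculant n (conn_R False) (conn_T True) (residues_of n s \<gamma>)"
    "\<Gamma>4 = bicirculant n (conn_R True) (conn_T True) (residues_of n s \<gamma>)"
    by (simp_all add: \<Gamma>1 \<Gamma>2 \<Gamma>3 \<Gamma>4 RTS conn_R_def conn_T_def)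
  show ?thesis
    using num_forests[folded polys graphs, OF degrees(1) roots(1)]
      num_forests_half[where p = True and q = False, folded polys graphs, OF _ degrees(1) roots(1) degrees(2) roots(2)]
      num_forests_half[where p = False and q = True, folded polys graphs, OF _ degrees(1) roots(1) degrees(3) roots(3)]
      num_forests_half[where p = True and q = True, folded polys graphs, OF _ degrees(1) roots(1) degrees(4) roots(4)]
    unfolding leading by blast
qed

end
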